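(* Let $\Psi$ be a Hausdorff locally convex space over $\mathbb{R}$. Let $\{\mu_t\}_{t\ge0}$ be a family of cylindrical measures on $\Psi'$ such that for every finite collection $\psi_1,\psi_2,\dots,\psi_n\in\Psi$, the family $\{\mu_t\circ\pi^{-1}_{\psi_1,\psi_2,\dots,\psi_n}\}_{t\ge0}$ is a continuous convolution semigroup of probability measures on $\mathbb{R}^n$. Then there exists a cylindrical process $L=\{L_t\}_{t\ge0}$ in $\Psi'$ defined on a probability space $(\Omega,\mathscr{F},\mathbb{P})$, such that: (1) for every $t\ge0$, $\psi_1,\psi_2,\dots,\psi_n\in\Psi$ and $\Gamma\in\mathcal{B}(\mathbb{R}^n)$, $$\mathbb{P}\left((L_t(\psi_1),L_t(\psi_2),\dots,L_t(\psi_n))\in\Gamma\right)=\mu_t\circ\pi^{-1}_{\psi_1,\psi_2,\dots,\psi_n}(\Gamma);$$ (2) $L$ is a cylindrical Lévy process in $\Psi'$.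
   Context: $\Psi'$ is the topological dual of $\Psi$, $f[\psi]$ the pairing, and $\pi_{\psi_1,\dots,\psi_n}:\Psi'\to\mathbb{R}^n$, $\pi_{\psi_1,\dots,\psi_n}(f)=(f[\psi_1],\dots,f[\psi_n])$. For $M\subseteq\Psi$, a cylindrical set based on $M$ is a set $\pi_{\psi_1,\dots,\psi_n}^{-1}(A)$ with $n\ge1$, $\psi_1,\dots,\psi_n\in M$, $A\in\mathcal{B}(\mathbb{R}^n)$; $\mathcal{C}(\Psi',M)$ is the $\sigma$-algebra generated by them and $\mathcal{Z}(\Psi')$ is the algebra of all cylindrical sets based on $\Psi$. A cylindrical measure on $\Psi'$ is a function $\mu:\mathcal{Z}(\Psi')\to[0,\infty]$ whose restriction to $\mathcal{C}(\Psi',M)$ is a measure for each finite $M\subseteq\Psi$. A continuous convolution semigroup of probability measures on $\mathbb{R}^n$ is a family $\{\lambda_t\}_{t\ge0}$ with $\lambda_s\ast\lambda_t=\lambda_{s+t}$, $\lambda_0=\delta_0$, and $t\mapsto\lambda_t$ continuous on $[0,\infty)$ in the weak topology. $L^0(\Omega,\mathscr{F},\mathbb{P})$ is the space of equivalence classes of real random variables. A cylindrical random variable in $\Psi'$ is a linear map $\Psi\to L^0(\Omega,\mathscr{F},\mathbb{P})$; a cylindrical process is a family $\{L_t\}_{t\ge0}$ of these. It is a cylindrical Lévy process if for all $n\ge1$ and $\psi_1,\dots,\psi_n\in\Psi$ the $\mathbb{R}^n$-valued process $\{(L_t(\psi_1),\dots,L_t(\psi_n))\}_{t\ge0}$ is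 a Lévy process. *)

theory Defs
  imports "HOL-Probability.Probability"
begin

section \<open>Locally convex spaces and their duals\<close>

definition locally_convex_space :: "'a::real_vector topology \<Rightarrow> bool" where
  "locally_convex_space T \<longleftrightarrow>
     topspace T = UNIV \<and>
     continuous_map (prod_topology T T) T (\<lambda>(x, y). x + y) \<and>
     continuous_map (prod_topology euclideanreal T) T (\<lambda>(c, x). c *\<^sub>R x) \<and>
     (\<forall>U. openin T U \<and> 0 \<in> U \<longrightarrow> (\<exists>V. openin T V \<and> convex V \<and> 0 \<in> V \<and> V \<subseteq> U))"

definition dual_space :: "'a::real_vector topology \<Rightarrow> ('a \<Rightarrow> real) set" where
  "dual_space T = {f. linear f \<and> continuous_map T euclideanreal f}"


section \<open>The space of real n-tuples\<close>

text \<open>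
  The dimension \<open>n\<close> is quantified inside the definitions below, so it cannot be a type.
  A vector of length \<open>n\<close> is an extensional function on \<open>{..<n}\<close>.
\<close>

abbreviation Rn_top :: "nat \<Rightarrow> (nat \<Rightarrow> real) topology" where
  "Rn_top n \<equiv> product_topology (\<lambda>_. euclideanreal) {..<n}"

abbreviation Rn :: "nat \<Rightarrow> (nat \<Rightarrow> real) measure" where
  "Rn n \<equiv> PiM {..<n} (\<lambda>_. borel)"

lemma topspace_Rn_top: "topspace (Rn_top n) = space (Rn n)"
  by (simp add: space_PiM)

lemma sets_Rn_eq_borel: "sets (Rn n) = sigma_sets (space (Rn n)) {U. openin (Rn_top n) U}"
proof (intro equalityI)
  let ?B = "sigma (space (Rn n)) {U. openin (Rn_top n) U}"
  have sub: "{U. openin (Rn_top n) U} \<subseteq> Pow (space (Rn n))"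
    using openin_subset[of "Rn_top n"] unfolding topspace_Rn_top by auto
  have comp: "(\<lambda>x. x i) \<in> borel_measurable ?B" if i: "i < n" for i
  proof (rule borel_measurableI)
    fix S :: "real set" assume S: "open S"
    have "continuous_map (Rn_top n) euclideanreal (\<lambda>x. x i)"
      using i by (intro continuous_map_product_projection) auto
    then have "openin (Rn_top n) {x \<in> topspace (Rn_top n). x i \<in> S}"
      using S by (intro openin_continuous_map_preimage) auto
    moreover have "(\<lambda>x. x i) -` S \<inter> space ?B = {x \<in> topspace (Rn_top n). x i \<in> S}"
      using sub by (subst topspace_Rn_top) (auto simp: space_measure_of_conv)
    ultimately show "(\<lambda>x. x i) -` S \<inter> space ?B \<in> sets ?B"
      using sub by (auto simp: sets_measure_of)
  qed
  have id: "(\<lambda>x. x) \<in> measurable ?B (Rn n)"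
  proof (rule measurable_PiM_single')
    show "(\<lambda>x. x) \<in> space ?B \<rightarrow> (\<Pi>\<^sub>E i\<in>{..<n}. space borel)"
      by (auto simp: space_measure_of_conv space_PiM)
  qed (use comp in auto)
  show "sets (Rn n) \<subseteq> sigma_sets (space (Rn n)) {U. openin (Rn_top n) U}"
  proof
    fix A assume A: "A \<in> sets (Rn n)"
    from measurable_sets[OF id A] have "A \<inter> space (Rn n) \<in> sets ?B"
      by (simp add: space_measure_of_conv)
    then show "A \<in> sigma_sets (space (Rn n)) {U. openin (Rn_top n) U}"
      using sub sets.sets_into_space[OF A] by (simp add: sets_measure_of Int_absorb2)
  qed
  show "sigma_sets (space (Rn n)) {U. openin (Rn_top n) U} \<subseteq> sets (Rn n)"
  proof (rule sets.sigma_sets_subset, safe)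
    fix U assume U: "openin (Rn_top n) U"
    let ?r = "\<lambda>x::nat \<Rightarrow> real. restrict x {..<n}"
    let ?e = "\<lambda>x i::nat. if i < n then x i else (0::real)"
    have "continuous_map (product_topology (\<lambda>_. euclideanreal) UNIV) (Rn_top n) ?r"
      unfolding continuous_map_componentwise
      by (auto intro: continuous_map_product_projection)
    from openin_continuous_map_preimage[OF this U] have "open {x. ?r x \<in> U}"
      unfolding euclidean_product_topology by (simp flip: open_openin)
    then have B: "{x. ?r x \<in> U} \<in> sets (PiM UNIV (\<lambda>_::nat. borel :: real measure))"
      by (simp add: sets_PiM_equal_borel)
    have e: "?e \<in> measurable (Rn n) (PiM UNIV (\<lambda>_::nat. borel))"
    proof (rule measurable_PiM_single')
      show "(\<lambda>x. ?e x i) \<in> borel_measurable (Rn n)" for i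
        by (cases "i < n") auto
    qed auto
    have "?r (?e x) = x" if "x \<in> space (Rn n)" for x
      using that by (auto simp: space_PiM PiE_def extensional_def)
    moreover have "U \<subseteq> space (Rn n)"
      using openin_subset[OF U] unfolding topspace_Rn_top .
    ultimately have "?e -` {x. ?r x \<in> U} \<inter> space (Rn n) = U" by auto
    with measurable_sets[OF e B] show "U \<in> sets (Rn n)" by simp
  qed
qed


section \<open>Cylindrical measures\<close>

definition cyl_proj :: "nat \<Rightarrow> (nat \<Rightarrow> 'a) \<Rightarrow> ('a \<Rightarrow> real) \<Rightarrow> (nat \<Rightarrow> real)" where
  "cyl_proj n \<psi> f = (\<lambda>i\<in>{..<n}. f (\<psi> i))"

definition cyl_set :: "'a::real_vector topology \<Rightarrow> nat \<Rightarrow> (nat \<Rightarrow> 'a) \<Rightarrow> (nat \<Rightarrow> real) set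
    \<Rightarrow> ('a \<Rightarrow> real) set" where
  "cyl_set T n \<psi> A = cyl_proj n \<psi> -` A \<inter> dual_space T"

definition cyl_sets :: "'a::real_vector topology \<Rightarrow> 'a set \<Rightarrow> ('a \<Rightarrow> real) set set" where
  "cyl_sets T M = {cyl_set T n \<psi> A | n \<psi> A. n \<ge> 1 \<and> (\<forall>i<n. \<psi> i \<in> M) \<and> A \<in> sets (Rn n)}"

definition cyl_sigma :: "'a::real_vector topology \<Rightarrow> 'a set \<Rightarrow> ('a \<Rightarrow> real) set set" where
  "cyl_sigma T M = sigma_sets (dual_space T) (cyl_sets T M)"

text \<open>
  A cylindrical measure is a function on \<open>cyl_sets T UNIV\<close>. This family contains
  \<open>cyl_sigma T M\<close> for every finite \<open>M\<close>, so the values of \<open>\<mu>\<close> outside it are never used.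
\<close>

definition cylindrical_measure ::
    "'a::real_vector topology \<Rightarrow> (('a \<Rightarrow> real) set \<Rightarrow> ennreal) \<Rightarrow> bool" where
  "cylindrical_measure T \<mu> \<longleftrightarrow>
     (\<forall>M. finite M \<longrightarrow> measure_space (dual_space T) (cyl_sigma T M) \<mu>)"

text \<open>The image \<open>\<mu> \<circ> \<pi>\<^sup>-\<^sup>1\<close> of a cylindrical measure under \<open>\<pi> = cyl_proj n \<psi>\<close>.\<close>

definition cyl_image :: "'a::real_vector topology \<Rightarrow> (('a \<Rightarrow> real) set \<Rightarrow> ennreal) \<Rightarrow> nat
    \<Rightarrow> (nat \<Rightarrow> 'a) \<Rightarrow> (nat \<Rightarrow> real) measure" where
  "cyl_image T \<mu> n \<psi> =
     distr (measure_of (dual_space T) (cyl_sigma T (\<psi> ` {..<n})) \<mu>) (Rn n) (cyl_proj n \<psi>)"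

lemma emeasure_cyl_image:
  assumes \<mu>: "cylindrical_measure T \<mu>" and n: "n \<ge> 1" and A: "A \<in> sets (Rn n)"
  shows "emeasure (cyl_image T \<mu> n \<psi>) A = \<mu> (cyl_set T n \<psi> A)"
proof -
  let ?S = "cyl_sigma T (\<psi> ` {..<n})"
  let ?M = "measure_of (dual_space T) ?S \<mu>"
  have ms: "measure_space (dual_space T) ?S \<mu>"
    using \<mu> by (auto simp: cylindrical_measure_def)
  then have sa: "sigma_algebra (dual_space T) ?S" by (simp add: measure_space_def)
  have pow: "?S \<subseteq> Pow (dual_space T)"
    using sa by (simp add: sigma_algebra_def algebra_def ring_of_sets_def semiring_of_sets_def
        subset_class_def)
  have in_S: "cyl_set T n \<psi> B \<in> ?S" if "B \<in> sets (Rn n)" for B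
    using that n unfolding cyl_sigma_def cyl_sets_def by (intro sigma_sets.Basic) auto
  have sets_M: "sets ?M = ?S"
    using pow sa by (simp add: sets_measure_of sigma_algebra.sigma_sets_eq)
  have space_M: "space ?M = dual_space T"
    using pow by (simp add: space_measure_of)
  have "cyl_proj n \<psi> \<in> measurable ?M (Rn n)"
  proof (rule measurableI)
    show "cyl_proj n \<psi> f \<in> space (Rn n)" for f
      by (auto simp: cyl_proj_def space_PiM)
  next
    fix B assume "B \<in> sets (Rn n)"
    from in_S[OF this] show "cyl_proj n \<psi> -` B \<inter> space ?M \<in> sets ?M"
      by (simp only: sets_M space_M cyl_set_def)
  qed
  then have "emeasure (cyl_image T \<mu> n \<psi>) A = emeasure ?M (cyl_set T n \<psi> A)"
    using A by (simp add: cyl_image_def emeasure_distr space_M cyl_set_def)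
  also have "\<dots> = \<mu> (cyl_set T n \<psi> A)"
    using ms in_S[OF A] pow sa
    by (intro emeasure_measure_of_sigma) (auto simp: measure_space_def)
  finally show ?thesis .
qed


section \<open>Convolution semigroups\<close>

definition Rn_conv :: "nat \<Rightarrow> (nat \<Rightarrow> real) measure \<Rightarrow> (nat \<Rightarrow> real) measure \<Rightarrow> (nat \<Rightarrow> real) measure"
  where "Rn_conv n \<mu> \<nu> = distr (\<mu> \<Otimes>\<^sub>M \<nu>) (Rn n) (\<lambda>(x, y). \<lambda>i\<in>{..<n}. x i + y i)"

definition continuous_conv_semigroup :: "nat \<Rightarrow> (real \<Rightarrow> (nat \<Rightarrow> real) measure) \<Rightarrow> bool" where
  "continuous_conv_semigroup n \<nu> \<longleftrightarrow>
     (\<forall>t\<ge>0. prob_space (\<nu> t) \<and> sets (\<nu> t) = sets (Rn n)) \<and>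
     (\<forall>s\<ge>0. \<forall>t\<ge>0. Rn_conv n (\<nu> s) (\<nu> t) = \<nu> (s + t)) \<and>
     \<nu> 0 = return (Rn n) (\<lambda>i\<in>{..<n}. 0) \<and>
     (\<forall>f. continuous_map (Rn_top n) euclideanreal f \<and> bounded (f ` topspace (Rn_top n)) \<longrightarrow>
        continuous_on {0..} (\<lambda>t. integral\<^sup>L (\<nu> t) f))"


section \<open>Random variables modulo almost sure equality\<close>

definition L0 :: "'w measure \<Rightarrow> ('w \<Rightarrow> real) set set" where
  "L0 P = borel_measurable P //
     {(f, g). f \<in> borel_measurable P \<and> g \<in> borel_measurable P \<and> (AE \<omega> in P. f \<omega> = g \<omega>)}"

definition L0_add :: "'w measure \<Rightarrow> ('w \<Rightarrow> real) set \<Rightarrow> ('w \<Rightarrow> real) set \<Rightarrow> ('w \<Rightarrow> real) set" where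
  "L0_add P F G =
     {h \<in> borel_measurable P. \<exists>f\<in>F. \<exists>g\<in>G. AE \<omega> in P. h \<omega> = f \<omega> + g \<omega>}"

definition L0_scale :: "'w measure \<Rightarrow> real \<Rightarrow> ('w \<Rightarrow> real) set \<Rightarrow> ('w \<Rightarrow> real) set" where
  "L0_scale P c F = {h \<in> borel_measurable P. \<exists>f\<in>F. AE \<omega> in P. h \<omega> = c * f \<omega>}"

definition cylindrical_rv :: "'w measure \<Rightarrow> ('a::real_vector \<Rightarrow> ('w \<Rightarrow> real) set) \<Rightarrow> bool" where
  "cylindrical_rv P X \<longleftrightarrow>
     (\<forall>\<psi>. X \<psi> \<in> L0 P) \<and>
     (\<forall>\<psi> \<phi>. X (\<psi> + \<phi>) = L0_add P (X \<psi>) (X \<phi>)) \<and>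
     (\<forall>c \<psi>. X (c *\<^sub>R \<psi>) = L0_scale P c (X \<psi>))"

definition cylindrical_process ::
    "'w measure \<Rightarrow> (real \<Rightarrow> 'a::real_vector \<Rightarrow> ('w \<Rightarrow> real) set) \<Rightarrow> bool" where
  "cylindrical_process P L \<longleftrightarrow> (\<forall>t\<ge>0. cylindrical_rv P (L t))"


section \<open>Levy processes\<close>

text \<open>
  No path regularity is required: the coordinates of a cylindrical process are only given up to
  almost sure equality at each time, and all conditions below are invariant under such changes.
\<close>

definition levy_process :: "nat \<Rightarrow> 'w measure \<Rightarrow> (real \<Rightarrow> 'w \<Rightarrow> (nat \<Rightarrow> real)) \<Rightarrow> bool" where
  "levy_process n P X \<longleftrightarrow>
     prob_space P \<and>
     (\<forall>t\<ge>0. X t \<in> measurable P (Rn n)) \<and>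
     (AE \<omega> in P. X 0 \<omega> = (\<lambda>i\<in>{..<n}. 0)) \<and>
     (\<forall>m (t :: nat \<Rightarrow> real). 0 \<le> t 0 \<and> (\<forall>j<m. t j < t (Suc j)) \<longrightarrow>
        prob_space.indep_vars P (\<lambda>_. Rn n)
          (\<lambda>j \<omega>. \<lambda>i\<in>{..<n}. X (t (Suc j)) \<omega> i - X (t j) \<omega> i) {..<m}) \<and>
     (\<forall>s t. 0 \<le> s \<and> s \<le> t \<longrightarrow>
        distr P (Rn n) (\<lambda>\<omega>. \<lambda>i\<in>{..<n}. X t \<omega> i - X s \<omega> i) = distr P (Rn n) (X (t - s))) \<and>
     (\<forall>t\<ge>0. \<forall>\<epsilon>>0.
        ((\<lambda>s. measure P {\<omega> \<in> space P. L2_set (\<lambda>i. X s \<omega> i - X t \<omega> i) {..<n} > \<epsilon>})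
           \<longlongrightarrow> 0) (at t within {0..}))"

text \<open>
  The vector \<open>(L\<^sub>t(\<psi>\<^sub>1), \<dots>, L\<^sub>t(\<psi>\<^sub>n))\<close> of equivalence classes is handled through
  arbitrary representatives \<open>X t i \<in> L t (\<psi> i)\<close>.
\<close>

definition cylindrical_levy_process ::
    "'w measure \<Rightarrow> (real \<Rightarrow> 'a::real_vector \<Rightarrow> ('w \<Rightarrow> real) set) \<Rightarrow> bool" where
  "cylindrical_levy_process P L \<longleftrightarrow>
     cylindrical_process P L \<and>
     (\<forall>n\<ge>1. \<forall>\<psi> X. (\<forall>t\<ge>0. \<forall>i<n. X t i \<in> L t (\<psi> i)) \<longrightarrow>
        levy_process n P (\<lambda>t \<omega>. \<lambda>i\<in>{..<n}. X t i \<omega>))"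

end

theory Submission
  imports Defs
begin

text \<open>
  At a fixed time \<open>t\<close>, Kolmogorov's extension theorem turns the cylindrical measure \<open>\<mu> t\<close> into a
  probability measure \<open>Q t\<close> on \<open>\<real>\<close>-valued functions on \<open>\<Psi>\<close> with the product sigma-algebra.
  Measures there are determined by finitely many coordinates, so \<open>Q\<close> inherits the convolution
  semigroup property. For a finite set \<open>S\<close> of times take independent increments with laws
  \<open>Q (s - s')\<close>, where \<open>s'\<close> precedes \<open>s\<close> in \<open>S\<close>, and let the process be the sequence of their partial
  sums. Deleting a time from \<open>S\<close> merges two neighbouring increments, and by the semigroup property this
  does not change the law at the remaining times. So a second application of Kolmogorov's theorem,
  with index set \<open>[0, \<infinity>) \<times> \<Psi>\<close>, gives the process. Linearity in \<open>\<psi>\<close> holds almost surely because it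
  is a property of three coordinates that all elements of the dual have, and stochastic continuity
  is weak continuity of the semigroup at time \<open>0\<close>.
\<close>

section \<open>Products of probability measures\<close>

text \<open>Under a product measure the coordinates are independent, hence so are functions of
  disjoint blocks of them, and independence means that the joint law is the product of the
  laws.\<close>

lemma distr_PiM_blocks:
  assumes M: "\<And>i. prob_space (M i)" and I: "finite I"
    and K: "\<And>j. j \<in> S \<Longrightarrow> K j \<subseteq> I" "disjoint_family_on K S"
    and f: "\<And>j. j \<in> S \<Longrightarrow> f j \<in> measurable (PiM (K j) M) (N j)"
  shows "distr (PiM I M) (PiM S N) (\<lambda>\<xi>. \<lambda>j\<in>S. f j (restrict \<xi> (K j)))
    = PiM S (\<lambda>j. distr (PiM (K j) M) (N j) (f j))"
proof -
  have W: "prob_space (PiM I M)" by (intro prob_space_PiM M)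
  interpret W: prob_space "PiM I M" by (rule W)
  interpret product_prob_space M by (intro product_prob_spaceI M)
  have r: "(\<lambda>\<xi>. restrict \<xi> (K j)) \<in> measurable (PiM I M) (PiM (K j) M)" if "j \<in> S" for j
    using K(1)[OF that] by (rule measurable_restrict_subset)
  have comp: "(\<lambda>\<xi>. f j (restrict \<xi> (K j))) \<in> measurable (PiM I M) (N j)" if "j \<in> S" for j
    using measurable_comp[OF r[OF that] f[OF that]] by (simp add: comp_def)
  show ?thesis
  proof (cases "S = {}")
    \<comment> \<open>Independence is characterized by product laws for nonempty index sets. For
      empty \<open>S\<close> both sides are the probability measure on a one-point space.\<close>
    case True
    have "emeasure (distr (PiM I M) (PiM {} N) (\<lambda>\<xi>. \<lambda>j\<in>{}. f j (restrict \<xi> (K j)))) {\<lambda>k. undefined} = 1"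
      by (subst emeasure_distr) (auto simp: PiM_empty restrict_def prob_space.emeasure_space_1[OF W])
    then show ?thesis unfolding True
      by (intro measure_eqI) (auto simp: PiM_empty subset_singleton_iff)
  next
    case False
    have ind: "W.indep_vars M (\<lambda>i \<xi>. \<xi> i) I"
    proof (cases "I = {}")
      case True
      then show ?thesis unfolding W.indep_vars_def W.indep_sets_def by simp
    next
      case False
      have 1: "PiM I (\<lambda>i. distr (PiM I M) (M i) (\<lambda>\<xi>. \<xi> i)) = PiM I M"
        by (intro PiM_cong refl distr_PiM_component M)
      have 2: "distr (PiM I M) (PiM I M) (\<lambda>x. restrict x I) = PiM I M"
        using distr_restrict[OF order_refl I] by simp
      show ?thesis
        by (subst W.indep_vars_iff_distr_eq_PiM'[OF False]) (auto simp: 1 2)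
    qed
    have "W.indep_vars N (\<lambda>j \<xi>. f j (restrict \<xi> (K j))) S"
      using W.indep_vars_compose2[OF W.indep_vars_restrict[OF ind K] f] by simp
    then have "distr (PiM I M) (PiM S N) (\<lambda>\<xi>. \<lambda>j\<in>S. f j (restrict \<xi> (K j)))
      = PiM S (\<lambda>j. distr (PiM I M) (N j) (\<lambda>\<xi>. f j (restrict \<xi> (K j))))"
      by (subst (asm) W.indep_vars_iff_distr_eq_PiM'[OF False comp]) auto
    also have "\<dots> = PiM S (\<lambda>j. distr (PiM (K j) M) (N j) (f j))"
    proof (intro PiM_cong refl)
      fix j assume j: "j \<in> S"
      have "distr (PiM (K j) M) (N j) (f j)
        = distr (distr (PiM I M) (PiM (K j) M) (\<lambda>\<xi>. restrict \<xi> (K j))) (N j) (f j)"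
        by (subst distr_restrict[OF K(1)[OF j] I]) simp
      also have "\<dots> = distr (PiM I M) (N j) (\<lambda>\<xi>. f j (restrict \<xi> (K j)))"
        by (subst distr_distr[OF f[OF j] r[OF j]]) (simp add: comp_def)
      finally show "distr (PiM I M) (N j) (\<lambda>\<xi>. f j (restrict \<xi> (K j))) = distr (PiM (K j) M) (N j) (f j)" ..
    qed
    finally show ?thesis .
  qed
qed

lemma distr_PiM_singleton:
  assumes M: "\<And>i. prob_space (M i)" and f: "f \<in> measurable (M s) N"
  shows "distr (PiM {s} M) N (\<lambda>\<xi>. f (\<xi> s)) = distr (M s) N f"
proof -
  have "distr (M s) N f = distr (distr (PiM {s} M) (M s) (\<lambda>\<xi>. \<xi> s)) N f"
    by (simp add: distr_PiM_component M)
  also have "\<dots> = distr (PiM {s} M) N (\<lambda>\<xi>. f (\<xi> s))"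
    by (subst distr_distr[OF f]) (auto simp: comp_def)
  finally show ?thesis ..
qed

text \<open>Passes from a product indexed by two points to the binary product, the form in which
  convolution is stated, by independence of the two coordinates.\<close>

lemma distr_PiM_doubleton:
  assumes M: "\<And>i. prob_space (M i)" and rs: "r \<noteq> s"
    and f: "(\<lambda>(x, y). f x y) \<in> measurable (M r \<Otimes>\<^sub>M M s) N"
  shows "distr (PiM {r, s} M) N (\<lambda>\<xi>. f (\<xi> r) (\<xi> s)) = distr (M r \<Otimes>\<^sub>M M s) N (\<lambda>(x, y). f x y)"
proof -
  interpret W: prob_space "PiM {r, s} M" by (intro prob_space_PiM M)
  interpret product_prob_space M by (intro product_prob_spaceI M)
  have 1: "PiM {r, s} (\<lambda>i. distr (PiM {r, s} M) (M i) (\<lambda>\<xi>. \<xi> i)) = PiM {r, s} M"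
    by (intro PiM_cong refl distr_PiM_component M)
  have 2: "distr (PiM {r, s} M) (PiM {r, s} M) (\<lambda>x. restrict x {r, s}) = PiM {r, s} M"
    using distr_restrict[of "{r, s}" "{r, s}"] by simp
  have ind: "W.indep_vars M (\<lambda>i \<xi>. \<xi> i) {r, s}"
    by (subst W.indep_vars_iff_distr_eq_PiM') (use 1 2 in auto)
  have "W.indep_var (M r) ((\<lambda>\<xi>. \<xi> r) \<circ> (\<lambda>\<xi>. restrict \<xi> {r})) (M s) ((\<lambda>\<xi>. \<xi> s) \<circ> (\<lambda>\<xi>. restrict \<xi> {s}))"
    by (rule W.indep_var_compose[OF W.indep_var_restrict[OF ind]]) (use rs in auto)
  then have "W.indep_var (M r) (\<lambda>\<xi>. \<xi> r) (M s) (\<lambda>\<xi>. \<xi> s)" by (simp add: comp_def)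
  then have "distr (PiM {r, s} M) (M r \<Otimes>\<^sub>M M s) (\<lambda>\<xi>. (\<xi> r, \<xi> s)) = M r \<Otimes>\<^sub>M M s"
    by (simp add: W.indep_var_distribution_eq distr_PiM_component M)
  then have "distr (M r \<Otimes>\<^sub>M M s) N (\<lambda>(x, y). f x y)
    = distr (distr (PiM {r, s} M) (M r \<Otimes>\<^sub>M M s) (\<lambda>\<xi>. (\<xi> r, \<xi> s))) N (\<lambda>(x, y). f x y)" by simp
  also have "\<dots> = distr (PiM {r, s} M) N (\<lambda>\<xi>. f (\<xi> r) (\<xi> s))"
    by (subst distr_distr[OF f]) (auto simp: comp_def)
  finally show ?thesis ..
qed

section \<open>Processes with independent increments\<close>

text \<open>Gives the marginals of the projective limit as image measures rather than as values on
  embedded cylinders.\<close>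

lemma (in polish_projective) distr_lim_restrict:
  assumes "finite J" "J \<subseteq> I"
  shows "distr lim (PiM J (\<lambda>_. borel)) (\<lambda>\<omega>. restrict \<omega> J) = P J"
proof (rule measure_eqI)
  fix X assume "X \<in> sets (distr lim (PiM J (\<lambda>_. borel)) (\<lambda>\<omega>. restrict \<omega> J))"
  then have X: "X \<in> sets (PiM J (\<lambda>_. borel))" by simp
  have "(\<lambda>\<omega>. restrict \<omega> J) \<in> measurable lim (PiM J (\<lambda>_. borel))"
    by (subst measurable_cong_sets[OF sets_lim refl]) (intro measurable_restrict_subset assms)
  then have "emeasure (distr lim (PiM J (\<lambda>_. borel)) (\<lambda>\<omega>. restrict \<omega> J)) X = emeasure lim (emb I J X)"
    using X by (simp add: emeasure_distr prod_emb_def space_PiM)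
  also have "\<dots> = emeasure (P J) X"
    using assms X by (intro emeasure_lim_emb)
  finally show "emeasure (distr lim (PiM J (\<lambda>_. borel)) (\<lambda>\<omega>. restrict \<omega> J)) X = emeasure (P J) X" .
qed (simp add: sets_P assms)

text \<open>The inserted \<open>0\<close> is the time at which the process starts, so for
  nonnegative times the first increment runs from \<open>0\<close> to the least time of
  \<open>S\<close>. It also keeps \<open>Max\<close> away from the empty set.\<close>

definition pred_time :: "real set \<Rightarrow> real \<Rightarrow> real" where
  "pred_time S s = Max (insert 0 {r \<in> S. r < s})"

text \<open>Turns increments \<xi>, indexed by the times in \<open>S\<close>, into values of the
  process at the time-coordinate pairs in \<open>J\<close>. \<open>S\<close> may contain times that
  do not occur in \<open>J\<close>.\<close>

definition partial_sums :: "real set \<Rightarrow> (real \<times> 'i) set \<Rightarrow> (real \<Rightarrow> 'i \<Rightarrow> real) \<Rightarrow> real \<times> 'i \<Rightarrow> real" where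
  "partial_sums S J \<xi> = (\<lambda>p\<in>J. \<Sum>s | s \<in> S \<and> s \<le> fst p. \<xi> s (snd p))"

text \<open>The first two assumptions cover negative times too, so that \<open>incr S s\<close>
  below is a probability measure for every real \<open>s\<close>, as the lemmas on product measures
  demand.\<close>

locale function_conv_semigroup =
  fixes Q :: "real \<Rightarrow> ('i \<Rightarrow> real) measure"
  assumes prob_Q: "\<And>t. prob_space (Q t)"
    and sets_Q[measurable_cong]: "\<And>t. sets (Q t) = sets (PiM UNIV (\<lambda>_. borel))"
    and conv_Q: "\<And>s t. 0 \<le> s \<Longrightarrow> 0 \<le> t \<Longrightarrow>
      distr (Q s \<Otimes>\<^sub>M Q t) (PiM UNIV (\<lambda>_. borel)) (\<lambda>(x, y) i. x i + y i) = Q (s + t)"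
begin

definition incr :: "real set \<Rightarrow> real \<Rightarrow> ('i \<Rightarrow> real) measure" where
  "incr S s = Q (s - pred_time S s)"

lemma prob_incr: "prob_space (incr S s)"
  by (simp add: incr_def prob_Q)

lemma sets_incr[measurable_cong]: "sets (incr S s) = sets (PiM UNIV (\<lambda>_. borel))"
  by (simp add: incr_def sets_Q)

lemma measurable_partial_sums:
  fixes J :: "(real \<times> 'i) set" and M :: "real \<Rightarrow> ('i \<Rightarrow> real) measure"
  assumes "finite S" and M: "\<And>s. s \<in> S \<Longrightarrow> sets (M s) = sets (PiM UNIV (\<lambda>_. borel))"
  shows "partial_sums S J \<in> measurable (PiM S M) (PiM J (\<lambda>_. borel))"
  unfolding partial_sums_def
proof (intro measurable_restrict borel_measurable_sum)
  fix p :: "real \<times> 'i" and s assume s: "s \<in> {s \<in> S. s \<le> fst p}"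
  then have "(\<lambda>x. x (snd p)) \<in> borel_measurable (M s)"
    by (subst measurable_cong_sets[OF M refl]) auto
  with s show "(\<lambda>\<xi>. \<xi> s (snd p)) \<in> borel_measurable (PiM S M)"
    by (intro measurable_compose[OF measurable_component_singleton[of s]]) auto
qed

lemma prob_PiM_incr: "prob_space (PiM S (incr S'))"
  by (intro prob_space_PiM prob_incr)

text \<open>An element \<open>s\<close> of \<open>S\<close> between \<open>r\<close> and
  \<open>j\<close> hides \<open>r\<close> from \<open>j\<close>. Together with the next two lemmas
  this shows that inserting \<open>r\<close> can change the predecessor of only one time in
  \<open>S\<close>, the next one after \<open>r\<close>.\<close>

lemma pred_time_insert_less:
  assumes S: "finite S" and s: "s \<in> S" "r < s" "s < j"
  shows "pred_time (insert r S) j = pred_time S j"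
proof -
  have "{q \<in> insert r S. q < j} = insert r {q \<in> S. q < j}" using s by auto
  then have "pred_time (insert r S) j = max r (pred_time S j)"
    using S by (simp add: pred_time_def insert_commute[of 0 r])
  moreover have "s \<le> pred_time S j"
    using S s unfolding pred_time_def by (intro Max_ge) auto
  ultimately show ?thesis using s by simp
qed

lemma pred_time_insert_ge: "j \<le> r \<Longrightarrow> pred_time (insert r S) j = pred_time S j"
  unfolding pred_time_def by (intro arg_cong[of _ _ "\<lambda>A. Max (insert 0 A)"]) auto

lemma pred_time_insert_next:
  assumes S: "finite S" and s: "r < s" "\<And>q. q \<in> S \<Longrightarrow> r < q \<Longrightarrow> s \<le> q" and r: "0 \<le> r"
  shows "pred_time (insert r S) s = r"
  unfolding pred_time_def
proof (rule Max_eqI)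
  fix y assume "y \<in> insert 0 {q \<in> insert r S. q < s}"
  with r s(2)[of y] show "y \<le> r" by force
qed (use assms in auto)

text \<open>No time of \<open>S\<close> lies in the interval from \<open>r\<close> to the next time
  \<open>s\<close>, so both have the same earlier times.\<close>

lemma pred_time_eq_next:
  assumes s: "r < s" "\<And>q. q \<in> S \<Longrightarrow> r < q \<Longrightarrow> s \<le> q" and r: "r \<notin> S"
  shows "pred_time S r = pred_time S s"
proof -
  have "q < r \<longleftrightarrow> q < s" if "q \<in> S" for q
    using s(1) s(2)[OF that] r that by (cases "q = r") force+
  then have "{q \<in> S. q < r} = {q \<in> S. q < s}" by blast
  then show ?thesis by (simp add: pred_time_def)
qed

lemma pred_time_le: "finite S \<Longrightarrow> 0 \<le> s \<Longrightarrow> pred_time S s \<le> s"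
  unfolding pred_time_def by (intro Max.boundedI) auto

text \<open>Adding the increment at \<open>r\<close> to the one at the next time of \<open>S\<close>
  maps independent increments along \<open>insert r S\<close> to independent increments along
  \<open>S\<close> and keeps the partial sums at times of \<open>S\<close>. If \<open>r\<close>
  exceeds every time of \<open>S\<close>, its increment is dropped, and no pair in \<open>J\<close>
  sees it.\<close>

lemma partial_sums_insert:
  assumes S: "finite S" and r: "0 \<le> r" "r \<notin> S" and J: "fst ` J \<subseteq> S"
  shows "distr (PiM (insert r S) (incr (insert r S))) (PiM J (\<lambda>_. borel)) (partial_sums (insert r S) J)
    = distr (PiM S (incr S)) (PiM J (\<lambda>_. borel)) (partial_sums S J)"
proof -
  let ?S' = "insert r S" and ?E = "PiM UNIV (\<lambda>_::'i. borel::real measure)"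
  \<comment> \<open>Among the times in \<open>S\<close>, \<open>nxt\<close> singles out the least
    one after \<open>r\<close>; if there is none, it fails throughout \<open>S\<close>.
    \<open>K j\<close> is the block of increments along \<open>insert r S\<close> that merge into
    the increment at \<open>j\<close>.\<close>
  define nxt where "nxt j \<longleftrightarrow> r < j \<and> (\<forall>q\<in>S. r < q \<longrightarrow> j \<le> q)" for j
  define K where "K j = (if nxt j then {r, j} else {j})" for j
  define f :: "real \<Rightarrow> (real \<Rightarrow> 'i \<Rightarrow> real) \<Rightarrow> 'i \<Rightarrow> real"
    where "f j \<xi> = (if nxt j then (\<lambda>i. \<xi> r i + \<xi> j i) else \<xi> j)" for j \<xi>
  let ?g = "\<lambda>\<xi>. \<lambda>j\<in>S. f j (restrict \<xi> (K j))"
  have nxt_unique: "j = k" if "nxt j" "nxt k" "j \<in> S" "k \<in> S" for j k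
    using that unfolding nxt_def by force
  have K: "\<And>j. j \<in> S \<Longrightarrow> K j \<subseteq> ?S'" "disjoint_family_on K S"
    using r nxt_unique by (auto simp: K_def disjoint_family_on_def)
  have comp: "(\<lambda>\<xi>. \<xi> q i) \<in> borel_measurable (PiM A (incr B))" if "q \<in> A" for q i A B
  proof -
    have "(\<lambda>x. x i) \<in> borel_measurable (incr B q)"
      by (subst measurable_cong_sets[OF sets_incr refl]) auto
    then show ?thesis
      using that by (intro measurable_compose[OF measurable_component_singleton]) auto
  qed
  have f: "f j \<in> measurable (PiM (K j) (incr ?S')) ?E" if "j \<in> S" for j
    unfolding f_def by (intro measurable_PiM_single') (auto simp: K_def intro!: comp borel_measurable_add)
  have add: "(\<lambda>(x, y) i. x i + y i) \<in> measurable (incr ?S' r \<Otimes>\<^sub>M incr ?S' j) ?E" for j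
    by (simp add: split_beta') (intro measurable_PiM_single'; simp; measurable)
  have d: "distr (PiM (K j) (incr ?S')) ?E (f j) = incr S j" if j: "j \<in> S" for j
  proof (cases "nxt j")
    case True
    then have rj: "r < j" and n: "\<And>q. q \<in> S \<Longrightarrow> r < q \<Longrightarrow> j \<le> q" by (auto simp: nxt_def)
    have "distr (PiM (K j) (incr ?S')) ?E (f j) = distr (PiM {r, j} (incr ?S')) ?E (\<lambda>\<xi> i. \<xi> r i + \<xi> j i)"
      using True by (simp add: K_def f_def[abs_def])
    also have "\<dots> = distr (incr ?S' r \<Otimes>\<^sub>M incr ?S' j) ?E (\<lambda>(x, y) i. x i + y i)"
      using rj add by (intro distr_PiM_doubleton prob_incr) auto
    \<comment> \<open>The interval from the predecessor of \<open>j\<close> in \<open>S\<close> to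
      \<open>j\<close> is cut at \<open>r\<close>; the semigroup law then glues the two
      pieces.\<close>
    also have "\<dots> = distr (Q (r - pred_time S j) \<Otimes>\<^sub>M Q (j - r)) ?E (\<lambda>(x, y) i. x i + y i)"
      using pred_time_insert_next[OF S rj n] pred_time_eq_next[OF rj n] r by (simp add: incr_def pred_time_insert_ge)
    also have "\<dots> = incr S j"
      using rj pred_time_le[OF S, of r] r pred_time_eq_next[OF rj n] by (subst conv_Q) (auto simp: incr_def)
    finally show ?thesis .
  next
    case False
    \<comment> \<open>Either \<open>j \<le> r\<close>, or another time of \<open>S\<close> lies
      strictly between \<open>r\<close> and \<open>j\<close>.\<close>
    have "pred_time ?S' j = pred_time S j"
      using False pred_time_insert_ge[of j r S] pred_time_insert_less[OF S]
      unfolding nxt_def by (metis not_le)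
    then have "incr ?S' j = incr S j" by (simp add: incr_def)
    then have "distr (incr ?S' j) ?E (\<lambda>x. x) = incr S j"
      by (simp add: distr_id2 sets_incr)
    then show ?thesis
      using False distr_PiM_singleton[where M="incr ?S'" and f="\<lambda>x. x" and s=j and N="?E"]
      by (simp add: K_def f_def[abs_def] prob_incr measurable_ident_sets[OF sets_incr])
  qed
  \<comment> \<open>On the right the increment at \<open>r\<close> is counted as soon as
    \<open>r < t\<close>. On the left it is part of the increment at the next time after
    \<open>r\<close>, which is then at most \<open>t\<close> because \<open>t\<close> belongs to
    \<open>S\<close>.\<close>
  have p: "(\<Sum>j | j \<in> S \<and> j \<le> t. f j (restrict \<xi> (K j)) i) = (\<Sum>s | s \<in> ?S' \<and> s \<le> t. \<xi> s i)"
    if t: "t \<in> S" for \<xi> t i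
  proof -
    have fin: "finite {j \<in> S. j \<le> t}" using S by simp
    have "(\<Sum>j | j \<in> S \<and> j \<le> t. f j (restrict \<xi> (K j)) i)
      = (\<Sum>j | j \<in> S \<and> j \<le> t. \<xi> j i + (if nxt j then \<xi> r i else 0))"
      by (intro sum.cong) (auto simp: f_def K_def)
    also have "\<dots> = (\<Sum>j | j \<in> S \<and> j \<le> t. \<xi> j i) + (\<Sum>j | j \<in> S \<and> j \<le> t. if nxt j then \<xi> r i else 0)"
      by (rule sum.distrib)
    also have "\<dots> = (\<Sum>s | s \<in> ?S' \<and> s \<le> t. \<xi> s i)"
    proof (cases "r < t")
      case True
      let ?R = "{q \<in> S. r < q}" and ?m = "Min {q \<in> S. r < q}"
      have m: "?m \<in> ?R" using S True t by (intro Min_in) auto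
      have "nxt ?m" using S m by (auto simp: nxt_def)
      moreover have "?m \<le> t" using S True t by (intro Min_le) auto
      ultimately have "{j \<in> S. j \<le> t} \<inter> {j. nxt j} = {?m}"
        using nxt_unique m by blast
      then have "(\<Sum>j | j \<in> S \<and> j \<le> t. if nxt j then \<xi> r i else 0) = \<xi> r i"
        using fin by (simp add: sum.If_cases)
      moreover have "{s \<in> ?S'. s \<le> t} = insert r {s \<in> S. s \<le> t}" using True by auto
      ultimately show ?thesis using r fin by simp
    next
      case False
      then have "{j \<in> S. j \<le> t} \<inter> {j. nxt j} = {}" by (auto simp: nxt_def)
      then have "(\<Sum>j | j \<in> S \<and> j \<le> t. if nxt j then \<xi> r i else 0) = 0"
        using fin by (simp add: sum.If_cases)
      moreover have "{s \<in> ?S'. s \<le> t} = {s \<in> S. s \<le> t}" using False t r by auto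
      ultimately show ?thesis by simp
    qed
    finally show ?thesis .
  qed
  have partial_sums: "partial_sums S J (?g \<xi>) = partial_sums ?S' J \<xi>" for \<xi>
    unfolding partial_sums_def
  proof (intro restrict_ext)
    fix q assume "q \<in> J"
    then have q: "fst q \<in> S" using J by auto
    show "(\<Sum>s | s \<in> S \<and> s \<le> fst q. ?g \<xi> s (snd q)) = (\<Sum>s | s \<in> ?S' \<and> s \<le> fst q. \<xi> s (snd q))"
      unfolding p[OF q, symmetric] by (intro sum.cong) auto
  qed
  have "PiM S (incr S) = PiM S (\<lambda>j. distr (PiM (K j) (incr ?S')) ?E (f j))"
    by (intro PiM_cong refl d[symmetric])
  also have "\<dots> = distr (PiM ?S' (incr ?S')) (PiM S (\<lambda>_. ?E)) ?g"
    using S by (intro distr_PiM_blocks[symmetric] prob_incr K f) auto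
  finally have eq: "PiM S (incr S) = distr (PiM ?S' (incr ?S')) (PiM S (\<lambda>_. ?E)) ?g" .
  have "?g \<in> measurable (PiM ?S' (incr ?S')) (PiM S (\<lambda>_. ?E))"
    using K(1) by (intro measurable_restrict measurable_compose[OF measurable_restrict_subset f]) auto
  then show ?thesis
    unfolding eq by (subst distr_distr) (auto simp: comp_def partial_sums intro!: measurable_partial_sums S)
qed

text \<open>The times in \<open>H - S\<close> are inserted one by one.\<close>

lemma partial_sums_subset:
  assumes "finite H" "S \<subseteq> H" "H \<subseteq> {0..}" "fst ` J \<subseteq> S"
  shows "distr (PiM H (incr H)) (PiM J (\<lambda>_. borel)) (partial_sums H J)
    = distr (PiM S (incr S)) (PiM J (\<lambda>_. borel)) (partial_sums S J)"
proof -
  have S: "finite S" using assms finite_subset by auto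
  have "distr (PiM (R \<union> S) (incr (R \<union> S))) (PiM J (\<lambda>_. borel)) (partial_sums (R \<union> S) J)
    = distr (PiM S (incr S)) (PiM J (\<lambda>_. borel)) (partial_sums S J)"
    if "finite R" "R \<subseteq> {0..}" "R \<inter> S = {}" for R
    using that
  proof (induction R)
    case (insert r R)
    then have "distr (PiM (insert r (R \<union> S)) (incr (insert r (R \<union> S)))) (PiM J (\<lambda>_. borel)) (partial_sums (insert r (R \<union> S)) J)
      = distr (PiM (R \<union> S) (incr (R \<union> S))) (PiM J (\<lambda>_. borel)) (partial_sums (R \<union> S) J)"
      using S assms(4) by (intro partial_sums_insert) auto
    with insert show ?case by simp
  qed simp
  from this[of "H - S"] show ?thesis
    using assms by (auto simp: Un_absorb2 subset_iff)
qed

section \<open>Projective family of finite-dimensional distributions\<close>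

definition fdd :: "(real \<times> 'i) set \<Rightarrow> (real \<times> 'i \<Rightarrow> real) measure" where
  "fdd J = distr (PiM (fst ` J) (incr (fst ` J))) (PiM J (\<lambda>_. borel)) (partial_sums (fst ` J) J)"

text \<open>Consistency holds because the law for \<open>J\<close> may be computed from increments
  along the larger set of times of \<open>H\<close>. After that change only the values at pairs
  outside \<open>J\<close> have to be dropped.\<close>

sublocale polish_projective "{0..} \<times> UNIV" fdd
proof (rule polish_projective.intro, rule projective_family.intro)
  fix J H :: "(real \<times> 'i) set"
  assume JH: "J \<subseteq> H" "finite H" "H \<subseteq> {0..} \<times> UNIV"
  have "fdd J = distr (PiM (fst ` H) (incr (fst ` H))) (PiM J (\<lambda>_. borel)) (partial_sums (fst ` H) J)"
    unfolding fdd_def using JH by (intro partial_sums_subset[symmetric]) auto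
  also have "partial_sums (fst ` H) J = (\<lambda>f. restrict f J) \<circ> partial_sums (fst ` H) H"
    using JH(1) by (auto simp: partial_sums_def fun_eq_iff restrict_def)
  also have "distr (PiM (fst ` H) (incr (fst ` H))) (PiM J (\<lambda>_. borel)) \<dots>
    = distr (fdd H) (PiM J (\<lambda>_. borel)) (\<lambda>f. restrict f J)"
    unfolding fdd_def using JH
    by (intro distr_distr[symmetric] measurable_restrict_subset measurable_partial_sums sets_incr) auto
  finally show "fdd J = distr (fdd H) (PiM J (\<lambda>_. borel)) (\<lambda>f. restrict f J)" .
next
  fix J :: "(real \<times> 'i) set" assume "finite J" "J \<subseteq> {0..} \<times> UNIV"
  then show "prob_space (fdd J)"
    unfolding fdd_def
    by (intro prob_space.prob_space_distr prob_PiM_incr measurable_partial_sums sets_incr) auto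
qed

text \<open>The \<open>0\<close> branch makes the increment of index \<open>0\<close> the value at
  \<open>t 0\<close>, so there are \<open>m + 1\<close> independent increments, the first one
  starting at time \<open>0\<close>. They are the increments from which the partial sums were
  built.\<close>

lemma distr_increments:
  assumes t: "0 \<le> t 0" "\<And>j. j < m \<Longrightarrow> t j < t (Suc j)" and n: "1 \<le> n"
  shows "distr lim (PiM {..m} (\<lambda>_. PiM {..<n} (\<lambda>_. borel)))
      (\<lambda>\<omega>. \<lambda>j\<in>{..m}. \<lambda>i\<in>{..<n}. \<omega> (t j, \<psi> i) - (case j of 0 \<Rightarrow> 0 | Suc k \<Rightarrow> \<omega> (t k, \<psi> i)))
    = PiM {..m} (\<lambda>j. distr (Q (t j - (case j of 0 \<Rightarrow> 0 | Suc k \<Rightarrow> t k))) (PiM {..<n} (\<lambda>_. borel))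
        (\<lambda>x. \<lambda>i\<in>{..<n::nat}. x (\<psi> i)))"
proof -
  define S where "S = t ` {..m}"
  \<comment> \<open>Since \<open>n \<ge> 1\<close>, every time in \<open>S\<close> occurs in a pair
    of \<open>J\<close>, so \<open>fdd J\<close> is built on increments along exactly
    \<open>S\<close>.\<close>
  define J where "J = S \<times> \<psi> ` {..<n}"
  let ?R = "PiM {..<n} (\<lambda>_. borel :: real measure)"
  let ?f = "\<lambda>\<omega>. \<lambda>j\<in>{..m}. \<lambda>i\<in>{..<n}. \<omega> (t j, \<psi> i) - (case j of 0 \<Rightarrow> 0 | Suc k \<Rightarrow> \<omega> (t k, \<psi> i))"
  let ?h = "\<lambda>x. \<lambda>i\<in>{..<n}. x (\<psi> i) :: real"
  have less: "t j < t k" if "j < k" "k \<le> m" for j k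
    using that
  proof (induction k)
    case (Suc k)
    then show ?case using t(2)[of k] by (cases "j = k") auto
  qed simp
  then have mono: "t j \<le> t k \<longleftrightarrow> j \<le> k" if "j \<le> m" "k \<le> m" for j k
    using that by (metis less_eq_real_def linorder_not_less nat_neq_iff)
  have nonneg: "0 \<le> t j" if "j \<le> m" for j
    using t(1) mono[of 0 j] that by simp
  have S: "finite S" "S \<subseteq> {0..}" "fst ` J = S" and J: "finite J" "J \<subseteq> {0..} \<times> UNIV"
    using nonneg n by (auto simp: S_def J_def fst_image_times lessThan_empty_iff)
  have inj: "inj_on t {..m}"
    using mono by (intro inj_onI) (metis atMost_iff order_antisym order_refl)
  have f: "?f \<in> measurable (PiM J (\<lambda>_. borel)) (PiM {..m} (\<lambda>_. ?R))"
    by (intro measurable_restrict borel_measurable_diff)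
       (auto simp: J_def S_def split: nat.split intro!: measurable_component_singleton)
  have restr: "(\<lambda>\<omega>. restrict \<omega> J) \<in> measurable lim (PiM J (\<lambda>_. borel))"
    by (subst measurable_cong_sets[OF sets_lim refl]) (intro measurable_restrict_subset J)
  \<comment> \<open>\<open>t\<close> lists \<open>S\<close> in increasing order, so the predecessor
    of \<open>t j\<close> is the time listed just before it, or \<open>0\<close> if
    \<open>j = 0\<close>.\<close>
  have pred_time: "pred_time S (t j) = (case j of 0 \<Rightarrow> 0 | Suc k \<Rightarrow> t k)" if "j \<le> m" for j
    unfolding pred_time_def
  proof (intro Max_eqI)
    fix y assume "y \<in> insert 0 {r \<in> S. r < t j}"
    then show "y \<le> (case j of 0 \<Rightarrow> 0 | Suc k \<Rightarrow> t k)"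
      using that nonneg mono by (auto simp: S_def not_le[symmetric] split: nat.split)
  qed (use that less S(1) in \<open>auto simp: S_def split: nat.split\<close>)
  \<comment> \<open>Differences of consecutive partial sums telescope to the original
    increments.\<close>
  have f_partial_sums: "?f (partial_sums S J \<xi>) = (\<lambda>j\<in>{..m}. ?h (\<xi> (t j)))" for \<xi>
  proof (intro restrict_ext)
    fix j i assume ji: "j \<in> {..m}" "i \<in> {..<n}"
    have set: "{s \<in> S. s \<le> t k} = t ` {..k}" if "k \<le> m" for k
      using that mono by (auto simp: S_def)
    have partial_sums: "partial_sums S J \<xi> (t k, \<psi> i) = (\<Sum>l\<le>k. \<xi> (t l) (\<psi> i))" if "k \<le> m" for k
    proof -
      have "inj_on t {..k}" using inj that by (auto intro: inj_on_subset)
      then show ?thesis using that ji by (auto simp: partial_sums_def J_def S_def[symmetric] set sum.reindex) (auto simp: S_def)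
    qed
    show "partial_sums S J \<xi> (t j, \<psi> i) - (case j of 0 \<Rightarrow> 0 | Suc k \<Rightarrow> partial_sums S J \<xi> (t k, \<psi> i)) = \<xi> (t j) (\<psi> i)"
      using ji by (cases j) (auto simp: partial_sums)
  qed
  have h: "?h \<in> measurable (incr S s) ?R" for s
    by (subst measurable_cong_sets[OF sets_incr refl]) (intro measurable_restrict; simp)
  have h1: "(\<lambda>\<xi>. ?h (\<xi> s)) \<in> measurable (PiM {s} (incr S)) ?R" for s
    by (rule measurable_compose[where f="\<lambda>\<xi>. \<xi> s", OF _ h[of s]]) auto
  \<comment> \<open>\<open>?f\<close> reads only coordinates in \<open>J\<close>, so its law can be
    computed from the marginal \<open>fdd J\<close>.\<close>
  have "distr lim (PiM {..m} (\<lambda>_. ?R)) ?f = distr lim (PiM {..m} (\<lambda>_. ?R)) (\<lambda>\<omega>. ?f (restrict \<omega> J))"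
    by (intro distr_cong refl restrict_ext) (auto simp: J_def S_def split: nat.split)
  also have "\<dots> = distr (fdd J) (PiM {..m} (\<lambda>_. ?R)) ?f"
    using J distr_distr[OF f restr] by (simp add: distr_lim_restrict comp_def)
  also have "\<dots> = distr (PiM S (incr S)) (PiM {..m} (\<lambda>_. ?R)) (?f \<circ> partial_sums S J)"
    unfolding fdd_def S(3) by (intro distr_distr f measurable_partial_sums S sets_incr)
  \<comment> \<open>Each component now depends on the single block \<open>{t j}\<close>, and these
    blocks are disjoint because \<open>t\<close> is injective.\<close>
  also have "?f \<circ> partial_sums S J = (\<lambda>\<xi>. \<lambda>j\<in>{..m}. ?h (restrict \<xi> {t j} (t j)))"
    by (simp add: comp_def f_partial_sums)
  also have "distr (PiM S (incr S)) (PiM {..m} (\<lambda>_. ?R)) \<dots>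
    = PiM {..m} (\<lambda>j. distr (PiM {t j} (incr S)) ?R (\<lambda>\<xi>. ?h (\<xi> (t j))))"
    using inj S by (intro distr_PiM_blocks[where K="\<lambda>j. {t j}"] prob_incr)
      (use h1 in \<open>auto simp: S_def disjoint_family_on_def inj_on_def simp del: restrict_apply\<close>)
  also have "\<dots> = PiM {..m} (\<lambda>j. distr (Q (t j - (case j of 0 \<Rightarrow> 0 | Suc k \<Rightarrow> t k))) ?R ?h)"
    by (intro PiM_cong refl, subst distr_PiM_singleton[where M="incr S" and f="?h" and N="?R"]) (auto simp: h prob_Q incr_def pred_time)
  finally show ?thesis .
qed

end

section \<open>Extension of a cylindrical measure to the product space\<close>

definition cyl_space :: "'a::real_vector topology \<Rightarrow> (('a \<Rightarrow> real) set \<Rightarrow> ennreal) \<Rightarrow> 'a set \<Rightarrow> ('a \<Rightarrow> real) measure" where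
  "cyl_space T \<mu> M = measure_of (dual_space T) (cyl_sigma T M) \<mu>"

lemma cyl_space:
  assumes "cylindrical_measure T \<mu>" "finite M"
  shows space_cyl_space: "space (cyl_space T \<mu> M) = dual_space T"
    and sets_cyl_space: "sets (cyl_space T \<mu> M) = cyl_sigma T M"
    and emeasure_cyl_space: "A \<in> cyl_sigma T M \<Longrightarrow> emeasure (cyl_space T \<mu> M) A = \<mu> A"
proof -
  have ms: "measure_space (dual_space T) (cyl_sigma T M) \<mu>"
    using assms by (auto simp: cylindrical_measure_def)
  then have sa: "sigma_algebra (dual_space T) (cyl_sigma T M)" by (simp add: measure_space_def)
  then have pow: "cyl_sigma T M \<subseteq> Pow (dual_space T)"
    by (simp add: sigma_algebra_def algebra_def ring_of_sets_def semiring_of_sets_def subset_class_def)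
  show "space (cyl_space T \<mu> M) = dual_space T" "sets (cyl_space T \<mu> M) = cyl_sigma T M"
    using pow sa by (simp_all add: cyl_space_def sets_measure_of space_measure_of sigma_algebra.sigma_sets_eq)
  show "emeasure (cyl_space T \<mu> M) A = \<mu> A" if "A \<in> cyl_sigma T M"
    unfolding cyl_space_def using ms that pow sa
    by (intro emeasure_measure_of_sigma) (auto simp: measure_space_def)
qed

lemma cyl_sigma_mono: "M \<subseteq> N \<Longrightarrow> cyl_sigma T M \<subseteq> cyl_sigma T N"
  unfolding cyl_sigma_def cyl_sets_def by (intro sigma_sets_mono') blast

lemma measurable_cyl_space_coordinate:
  assumes \<mu>: "cylindrical_measure T \<mu>" "finite M" and \<psi>: "\<psi> \<in> M"
  shows "(\<lambda>f. f \<psi>) \<in> borel_measurable (cyl_space T \<mu> M)"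
proof (rule measurableI)
  fix B :: "real set" assume B: "B \<in> sets borel"
  let ?A = "{x \<in> space (Rn 1). x 0 \<in> B}"
  have "?A \<in> sets (Rn 1)" using B by measurable
  then have "cyl_set T 1 (\<lambda>_. \<psi>) ?A \<in> cyl_sigma T M"
    using \<psi> unfolding cyl_sigma_def cyl_sets_def by (intro sigma_sets.Basic) auto
  moreover have "(\<lambda>f. f \<psi>) -` B \<inter> space (cyl_space T \<mu> M) = cyl_set T 1 (\<lambda>_. \<psi>) ?A"
    by (auto simp: cyl_set_def cyl_proj_def space_cyl_space[OF \<mu>] space_PiM)
  ultimately show "(\<lambda>f. f \<psi>) -` B \<inter> space (cyl_space T \<mu> M) \<in> sets (cyl_space T \<mu> M)"
    by (simp add: sets_cyl_space[OF \<mu>])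
qed simp

lemma measurable_cyl_space_restrict:
  assumes \<mu>: "cylindrical_measure T \<mu>" "finite M" and J: "J \<subseteq> M"
  shows "(\<lambda>f. restrict f J) \<in> measurable (cyl_space T \<mu> M) (PiM J (\<lambda>_. borel))"
  using J by (intro measurable_restrict measurable_cyl_space_coordinate[OF \<mu>]) auto

text \<open>Kolmogorov's theorem is applied to the images of \<mu> under restriction to finite sets
  \<open>J\<close>. Countable additivity is available on \<open>cyl_sigma T J\<close> for each such
  \<open>J\<close>, and the extension lives on all real functions on the space rather than on the
  dual.\<close>

lemma cylindrical_measure_extension:
  fixes T :: "'a::real_vector topology"
  assumes \<mu>: "cylindrical_measure T \<mu>" and total: "\<mu> (dual_space T) = 1"
  shows "\<exists>Q. prob_space Q \<and> sets Q = sets (PiM UNIV (\<lambda>_. borel)) \<and>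
    (\<forall>n \<psi>. distr Q (Rn n) (cyl_proj n \<psi>) = cyl_image T \<mu> n \<psi>)"
proof -
  let ?P = "\<lambda>J. distr (cyl_space T \<mu> J) (PiM J (\<lambda>_. borel)) (\<lambda>f. restrict f J)"
  interpret polish_projective UNIV ?P
  proof (rule polish_projective.intro, rule projective_family.intro)
    fix J H :: "'a set" assume JH: "J \<subseteq> H" "finite H"
    then have J: "finite J" by (rule finite_subset)
    note rJ = measurable_cyl_space_restrict[OF \<mu> J order_refl]
      and rH = measurable_cyl_space_restrict[OF \<mu> JH(2) order_refl]
      and rHJ = measurable_cyl_space_restrict[OF \<mu> JH(2,1)]
    have "?P J = distr (cyl_space T \<mu> H) (PiM J (\<lambda>_. borel)) (\<lambda>f. restrict f J)"
    proof (rule measure_eqI)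
      fix X assume "X \<in> sets (?P J)"
      then have X: "X \<in> sets (PiM J (\<lambda>_. borel))" by simp
      \<comment> \<open>One set function \<mu> supplies all marginals: the preimage
        \<open>?Y\<close> lies in \<open>cyl_sigma T J\<close>, hence in
        \<open>cyl_sigma T H\<close>, and both measures give it the value of \<mu>.\<close>
      let ?Y = "(\<lambda>f. restrict f J) -` X \<inter> dual_space T"
      have Y: "?Y \<in> cyl_sigma T J"
        using measurable_sets[OF rJ X] by (simp add: space_cyl_space[OF \<mu> J] sets_cyl_space[OF \<mu> J])
      then have "?Y \<in> cyl_sigma T H" using cyl_sigma_mono[OF JH(1)] by blast
      then show "emeasure (?P J) X = emeasure (distr (cyl_space T \<mu> H) (PiM J (\<lambda>_. borel)) (\<lambda>f. restrict f J)) X"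
        using X Y by (simp add: emeasure_distr rJ rHJ space_cyl_space[OF \<mu>] emeasure_cyl_space[OF \<mu>] J JH)
    qed simp
    also have "\<dots> = distr (?P H) (PiM J (\<lambda>_. borel)) (\<lambda>f. restrict f J)"
      using JH by (subst distr_distr[OF measurable_restrict_subset rH])
        (auto simp: comp_def restrict_restrict Int_absorb1)
    finally show "?P J = distr (?P H) (PiM J (\<lambda>_. borel)) (\<lambda>f. restrict f J)" .
  next
    fix J :: "'a set" assume J: "finite J"
    have "dual_space T \<in> cyl_sigma T J" unfolding cyl_sigma_def by (rule sigma_sets_top)
    then have "emeasure (cyl_space T \<mu> J) (space (cyl_space T \<mu> J)) = 1"
      by (simp add: space_cyl_space[OF \<mu> J] emeasure_cyl_space[OF \<mu> J] total)
    then have "prob_space (cyl_space T \<mu> J)" by (rule prob_spaceI)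
    then show "prob_space (?P J)"
      by (rule prob_space.prob_space_distr) (rule measurable_cyl_space_restrict[OF \<mu> J order_refl])
  qed
  have "distr lim (Rn n) (cyl_proj n \<psi>) = cyl_image T \<mu> n \<psi>" for n and \<psi> :: "nat \<Rightarrow> 'a"
  proof -
    let ?J = "\<psi> ` {..<n}"
    have cp: "cyl_proj n \<psi> \<in> measurable (PiM ?J (\<lambda>_. borel)) (Rn n)"
      unfolding cyl_proj_def by (intro measurable_restrict measurable_component_singleton) auto
    have r: "(\<lambda>\<omega>. restrict \<omega> ?J) \<in> measurable lim (PiM ?J (\<lambda>_. borel))"
      by (subst measurable_cong_sets[OF sets_lim refl]) (intro measurable_restrict_subset; simp)
    have eq: "(\<lambda>f. cyl_proj n \<psi> (restrict f ?J)) = cyl_proj n \<psi>"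
      by (auto simp: cyl_proj_def fun_eq_iff)
    have "distr lim (Rn n) (cyl_proj n \<psi>) = distr (?P ?J) (Rn n) (cyl_proj n \<psi>)"
      using distr_distr[OF cp r] by (simp add: distr_lim_restrict comp_def eq)
    also have "\<dots> = cyl_image T \<mu> n \<psi>"
      using distr_distr[OF cp measurable_cyl_space_restrict[OF \<mu> _ order_refl]]
      by (simp add: comp_def eq cyl_image_def cyl_space_def)
    finally show ?thesis .
  qed
  then show ?thesis by (intro exI[of _ lim]) (auto intro: P.prob_space_axioms)
qed

section \<open>Finite-dimensional projections and convolution\<close>

lemma measurable_cyl_proj: "cyl_proj n \<psi> \<in> measurable (PiM UNIV (\<lambda>_. borel)) (Rn n)"
  unfolding cyl_proj_def by (intro measurable_restrict measurable_component_singleton) auto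

text \<open>Cylinders over boxes determine a finite measure on the product, and an enumeration of
  the finite base turns such a cylinder into a preimage under \<open>cyl_proj\<close>.\<close>

lemma measure_eqI_cyl_proj:
  assumes P: "prob_space P" "sets P = sets (PiM UNIV (\<lambda>_. borel))"
    and Q: "prob_space Q" "sets Q = sets (PiM UNIV (\<lambda>_. borel))"
    and eq: "\<And>n \<psi>. 1 \<le> n \<Longrightarrow> distr P (Rn n) (cyl_proj n \<psi>) = distr Q (Rn n) (cyl_proj n \<psi>)"
  shows "P = (Q :: ('a \<Rightarrow> real) measure)"
proof (rule measure_eqI_PiM_infinite[where I=UNIV and M="\<lambda>_. borel"])
  fix A :: "'a \<Rightarrow> real set" and J :: "'a set"
  assume J: "finite J" and A: "\<And>i. i \<in> J \<Longrightarrow> A i \<in> sets borel"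
  have sp: "space P = UNIV" "space Q = UNIV"
    using sets_eq_imp_space_eq[OF P(2)] sets_eq_imp_space_eq[OF Q(2)] by (simp_all add: space_PiM)
  let ?B = "prod_emb UNIV (\<lambda>_. borel) J (Pi\<^sub>E J A)"
  show "emeasure P ?B = emeasure Q ?B"
  proof (cases "J = {}")
    \<comment> \<open>Projections are compared for \<open>n \<ge> 1\<close>, so the cylinder with
      empty base, which is the whole space, is settled by total mass \<open>1\<close>.\<close>
    case True
    then show ?thesis
      using prob_space.emeasure_space_1[OF P(1)] prob_space.emeasure_space_1[OF Q(1)]
      by (simp add: sp prod_emb_def restrict_def)
  next
    case False
    obtain \<psi> :: "nat \<Rightarrow> 'a" where \<psi>: "bij_betw \<psi> {..<card J} J"
      using bij_betw_from_nat_into_finite[OF J] by blast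
    let ?C = "Pi\<^sub>E {..<card J} (\<lambda>i. A (\<psi> i))"
    have \<psi>J: "\<psi> ` {..<card J} = J" using \<psi> by (simp add: bij_betw_def)
    have C: "?C \<in> sets (Rn (card J))" using A \<psi>J by (intro sets_PiM_I_finite) auto
    have "(\<forall>i\<in>J. R i) \<longleftrightarrow> (\<forall>k\<in>{..<card J}. R (\<psi> k))" for R
      by (subst (1) \<psi>J[symmetric]) simp
    then have B: "?B = cyl_proj (card J) \<psi> -` ?C"
      by (auto simp: prod_emb_def cyl_proj_def PiE_iff)
    have "emeasure P ?B = emeasure (distr P (Rn (card J)) (cyl_proj (card J) \<psi>)) ?C"
      using C measurable_cyl_proj[of "card J" \<psi>] by (subst emeasure_distr) (auto simp: B sp measurable_cong_sets[OF P(2) refl])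
    also have "\<dots> = emeasure (distr Q (Rn (card J)) (cyl_proj (card J) \<psi>)) ?C"
      using False J by (subst eq) (auto simp: Suc_le_eq card_gt_0_iff)
    also have "\<dots> = emeasure Q ?B"
      using C measurable_cyl_proj[of "card J" \<psi>] by (subst emeasure_distr) (auto simp: B sp measurable_cong_sets[OF Q(2) refl])
    finally show ?thesis .
  qed
qed (use P Q in \<open>auto simp: prob_space_def\<close>)

text \<open>\<open>cyl_proj\<close> commutes with addition, and applying it to both factors of a
  product measure gives the product of the images.\<close>

lemma cyl_proj_convolution:
  assumes P: "prob_space P" and [measurable_cong]: "sets P = sets (PiM UNIV (\<lambda>_. borel))"
    and Q: "prob_space Q" and [measurable_cong]: "sets Q = sets (PiM UNIV (\<lambda>_. borel))"
  shows "distr (distr (P \<Otimes>\<^sub>M Q) (PiM UNIV (\<lambda>_. borel)) (\<lambda>(x, y) i. x i + y i)) (Rn n) (cyl_proj n \<psi>)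
    = Rn_conv n (distr P (Rn n) (cyl_proj n \<psi>)) (distr Q (Rn n) (cyl_proj n \<psi>))"
proof -
  note [measurable] = measurable_cyl_proj
  interpret P: prob_space P by fact
  interpret Q: prob_space Q by fact
  have Qs: "sigma_finite_measure (distr Q (Rn n) (cyl_proj n \<psi>))"
    by (intro prob_space_imp_sigma_finite Q.prob_space_distr) measurable
  have add: "(\<lambda>(x, y) i. x i + y i) \<in> measurable (P \<Otimes>\<^sub>M Q) (PiM UNIV (\<lambda>_. borel))"
    by (simp add: split_beta') (intro measurable_PiM_single'; simp)
  have add': "(\<lambda>(x, y). \<lambda>i\<in>{..<n}. x i + y i) \<in> measurable (Rn n \<Otimes>\<^sub>M Rn n) (Rn n)"
    by (simp add: split_beta')
  have "distr P (Rn n) (cyl_proj n \<psi>) \<Otimes>\<^sub>M distr Q (Rn n) (cyl_proj n \<psi>)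
    = distr (P \<Otimes>\<^sub>M Q) (Rn n \<Otimes>\<^sub>M Rn n) (\<lambda>(x, y). (cyl_proj n \<psi> x, cyl_proj n \<psi> y))"
    by (intro pair_measure_distr Qs) measurable
  then have "Rn_conv n (distr P (Rn n) (cyl_proj n \<psi>)) (distr Q (Rn n) (cyl_proj n \<psi>))
    = distr (P \<Otimes>\<^sub>M Q) (Rn n) ((\<lambda>(x, y). \<lambda>i\<in>{..<n}. x i + y i) \<circ> (\<lambda>(x, y). (cyl_proj n \<psi> x, cyl_proj n \<psi> y)))"
    unfolding Rn_conv_def by (simp add: distr_distr[OF add'])
  also have "\<dots> = distr (P \<Otimes>\<^sub>M Q) (Rn n) (cyl_proj n \<psi> \<circ> (\<lambda>(x, y) i. x i + y i))"
    by (intro arg_cong[of _ _ "distr _ _"]) (auto simp: fun_eq_iff cyl_proj_def)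
  also have "\<dots> = distr (distr (P \<Otimes>\<^sub>M Q) (PiM UNIV (\<lambda>_. borel)) (\<lambda>(x, y) i. x i + y i)) (Rn n) (cyl_proj n \<psi>)"
    by (intro distr_distr[symmetric] measurable_cyl_proj add)
  finally show ?thesis ..
qed

section \<open>Levy processes and almost sure equivalence\<close>

text \<open>With a single index the only increment runs from time \<open>0\<close> to
  \<open>t\<close>, so it is the value at \<open>t\<close>; the \<open>Suc\<close> branches are
  never reached.\<close>

lemma distr_increments_0:
  assumes law: "distr P (PiM {..0} (\<lambda>_. Rn n))
      (\<lambda>\<omega>. \<lambda>j\<in>{..0}. \<lambda>i\<in>{..<n}. X i \<omega> - (case j of 0 \<Rightarrow> 0 | Suc k \<Rightarrow> X i \<omega>))
    = PiM {..0::nat} (\<lambda>j. \<nu> (t - (case j of 0 \<Rightarrow> 0 | Suc k \<Rightarrow> t)))"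
    and meas: "\<And>i. i < n \<Longrightarrow> X i \<in> borel_measurable P"
    and \<nu>: "prob_space (\<nu> t)" "sets (\<nu> t) = sets (Rn n)"
  shows "distr P (Rn n) (\<lambda>\<omega>. \<lambda>i\<in>{..<n}. X i \<omega>) = \<nu> (t :: real)"
proof -
  let ?D = "\<lambda>\<omega>. \<lambda>j\<in>{..0::nat}. \<lambda>i\<in>{..<n}. X i \<omega> - (case j of 0 \<Rightarrow> 0 | Suc k \<Rightarrow> X i \<omega>)"
  have D: "?D \<in> measurable P (PiM {..0} (\<lambda>_. Rn n))"
    by (intro measurable_restrict) (auto intro: meas)
  have "distr P (Rn n) (\<lambda>\<omega>. \<lambda>i\<in>{..<n}. X i \<omega>) = distr P (Rn n) ((\<lambda>\<xi>. \<xi> 0) \<circ> ?D)"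
    by (simp add: comp_def)
  also have "\<dots> = distr (PiM {..0} (\<lambda>j. \<nu> (t - (case j of 0 \<Rightarrow> 0 | Suc k \<Rightarrow> t)))) (Rn n) (\<lambda>\<xi>. \<xi> 0)"
    by (subst distr_distr[symmetric, OF _ D]) (auto simp: law[simplified])
  also have "\<dots> = \<nu> t"
    using distr_PiM_component[of "{..0}" "\<lambda>j. \<nu> (t - (case j of 0 \<Rightarrow> 0 | Suc k \<Rightarrow> t))" 0]
    by (simp add: \<nu> cong: distr_cong)
  finally show ?thesis .
qed

text \<open>The joint law of the increments along finite grids yields every condition: two times
  give stationarity, dropping the initial increment gives independence, \<nu> at \<open>0\<close>
  gives the start, and weak continuity at \<open>0\<close> gives stochastic continuity.\<close>

lemma levy_processI:
  fixes X :: "real \<Rightarrow> nat \<Rightarrow> 'w \<Rightarrow> real"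
  assumes P: "prob_space P" and \<nu>: "continuous_conv_semigroup n \<nu>"
    and meas: "\<And>t i. 0 \<le> t \<Longrightarrow> i < n \<Longrightarrow> X t i \<in> borel_measurable P"
    and law: "\<And>m t. 0 \<le> t 0 \<Longrightarrow> (\<And>j. j < m \<Longrightarrow> t j < t (Suc j)) \<Longrightarrow>
      distr P (PiM {..m} (\<lambda>_. Rn n))
        (\<lambda>\<omega>. \<lambda>j\<in>{..m}. \<lambda>i\<in>{..<n}. X (t j) i \<omega> - (case j of 0 \<Rightarrow> 0 | Suc k \<Rightarrow> X (t k) i \<omega>))
      = PiM {..m} (\<lambda>j. \<nu> (t j - (case j of 0 \<Rightarrow> 0 | Suc k \<Rightarrow> t k)))"
  shows "levy_process n P (\<lambda>t \<omega>. \<lambda>i\<in>{..<n}. X t i \<omega>)"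
proof -
  interpret prob_space P by (rule P)
  have prob_\<nu>: "prob_space (\<nu> t)" and sets_\<nu>: "sets (\<nu> t) = sets (Rn n)" if "0 \<le> t" for t
    using \<nu> that by (auto simp: continuous_conv_semigroup_def)
  have \<nu>0: "\<nu> 0 = return (Rn n) (\<lambda>i\<in>{..<n}. 0)"
    using \<nu> by (simp add: continuous_conv_semigroup_def)
  have V: "(\<lambda>\<omega>. \<lambda>i\<in>{..<n}. X t i \<omega>) \<in> measurable P (Rn n)" if "0 \<le> t" for t
    using that by (intro measurable_restrict meas) auto
  have V2: "(\<lambda>\<omega>. \<lambda>i\<in>{..<n}. X t i \<omega> - X s i \<omega>) \<in> measurable P (Rn n)" if "0 \<le> s" "0 \<le> t" for s t
    using that by (intro measurable_restrict borel_measurable_diff meas) auto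
  have D_meas: "(\<lambda>\<omega>. X (t j) i \<omega> - (case j of 0 \<Rightarrow> 0 | Suc k \<Rightarrow> X (t k) i \<omega>)) \<in> borel_measurable P"
    if "\<And>k. k \<le> j \<Longrightarrow> 0 \<le> t k" "i < n" for t :: "nat \<Rightarrow> real" and i j
    using that by (cases j) (auto intro!: borel_measurable_diff meas)
  have marginal: "distr P (Rn n) (\<lambda>\<omega>. \<lambda>i\<in>{..<n}. X t i \<omega>) = \<nu> t" if t: "0 \<le> t" for t
    using law[of "\<lambda>_. t" 0, OF t] by (rule distr_increments_0) (simp_all add: meas prob_\<nu> sets_\<nu> t)
  have increment: "distr P (Rn n) (\<lambda>\<omega>. \<lambda>i\<in>{..<n}. X t i \<omega> - X s i \<omega>) = \<nu> (t - s)"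
    if st: "0 \<le> s" "s \<le> t" for s t
  proof (cases "s = t")
    \<comment> \<open>\<open>law\<close> asks for strictly increasing times; for equal times both
      sides are the point mass at zero.\<close>
    case True
    then show ?thesis by (simp add: \<nu>0 distr_const[OF _] space_PiM)
  next
    case False
    \<comment> \<open>A grid of two times with \<open>m = 1\<close>; the wanted increment is its
      component of index \<open>1\<close>.\<close>
    let ?t = "\<lambda>j::nat. if j = 0 then s else t"
    let ?D = "\<lambda>\<omega>. \<lambda>j\<in>{..1}. \<lambda>i\<in>{..<n}. X (?t j) i \<omega> - (case j of 0 \<Rightarrow> 0 | Suc k \<Rightarrow> X (?t k) i \<omega>)"
    let ?\<nu> = "\<lambda>j. \<nu> (?t j - (case j of 0 \<Rightarrow> 0 | Suc k \<Rightarrow> ?t k))"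
    have D: "?D \<in> measurable P (PiM {..1} (\<lambda>_. Rn n))"
      using st by (intro measurable_restrict D_meas) auto
    have "distr P (Rn n) (\<lambda>\<omega>. \<lambda>i\<in>{..<n}. X t i \<omega> - X s i \<omega>) = distr P (Rn n) ((\<lambda>\<xi>. \<xi> 1) \<circ> ?D)"
      by (simp add: comp_def)
    also have "\<dots> = distr (PiM {..1} ?\<nu>) (Rn n) (\<lambda>\<xi>. \<xi> 1)"
      using law[of ?t 1] st False by (subst distr_distr[symmetric, OF _ D]) auto
    also have "\<dots> = \<nu> (t - s)"
    proof -
      have "distr (PiM {..1} ?\<nu>) (?\<nu> 1) (\<lambda>\<xi>. \<xi> 1) = ?\<nu> 1"
        using st by (intro distr_PiM_component) (auto intro!: prob_\<nu> split: nat.split)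
      moreover have "distr (PiM {..1} ?\<nu>) (Rn n) (\<lambda>\<xi>. \<xi> 1) = distr (PiM {..1} ?\<nu>) (?\<nu> 1) (\<lambda>\<xi>. \<xi> 1)"
        using st by (intro distr_cong) (auto simp: sets_\<nu>)
      ultimately show ?thesis by simp
    qed
    finally show ?thesis .
  qed
  have start: "AE \<omega> in P. (\<lambda>i\<in>{..<n}. X 0 i \<omega>) = (\<lambda>i\<in>{..<n}. 0)"
  proof -
    have "{x \<in> space (Rn n). \<forall>i\<in>{..<n}. x i = 0} \<in> sets (Rn n)" by measurable
    moreover have "AE x in distr P (Rn n) (\<lambda>\<omega>. \<lambda>i\<in>{..<n}. X 0 i \<omega>). \<forall>i\<in>{..<n}. x i = 0"
      unfolding marginal[OF order_refl] \<nu>0 by (subst AE_return) (auto simp: space_PiM)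
    ultimately show ?thesis
      using V[of 0] by (subst (asm) AE_distr_iff) (auto elim!: eventually_mono)
  qed
  have indep: "indep_vars (\<lambda>_. Rn n) (\<lambda>j \<omega>. \<lambda>i\<in>{..<n}. X (t (Suc j)) i \<omega> - X (t j) i \<omega>) {..<m}"
    if t: "0 \<le> t 0" "\<And>j. j < m \<Longrightarrow> t j < t (Suc j)" for m and t :: "nat \<Rightarrow> real"
  proof (cases "m = 0")
    case True
    then show ?thesis unfolding indep_vars_def indep_sets_def by simp
  next
    case False
    have nonneg: "0 \<le> t j" if "j \<le> m" for j
      using that
    proof (induction j)
      case (Suc j)
      then show ?case using t(2)[of j] by simp
    qed (use t in simp)
    let ?D = "\<lambda>j \<omega>. \<lambda>i\<in>{..<n}. X (t j) i \<omega> - (case j of 0 \<Rightarrow> 0 | Suc k \<Rightarrow> X (t k) i \<omega>)"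
    let ?\<nu> = "\<lambda>j. \<nu> (t j - (case j of 0 \<Rightarrow> 0 | Suc k \<Rightarrow> t k))"
    let ?I = "\<lambda>j \<omega>. \<lambda>i\<in>{..<n}. X (t (Suc j)) i \<omega> - X (t j) i \<omega>"
    have D: "(\<lambda>\<omega>. \<lambda>j\<in>{..m}. ?D j \<omega>) \<in> measurable P (PiM {..m} (\<lambda>_. Rn n))"
      by (intro measurable_restrict D_meas) (auto intro: nonneg)
    have I: "?I j \<in> measurable P (Rn n)" if "j < m" for j
      using that nonneg by (intro V2) auto
    \<comment> \<open>Dropping index \<open>0\<close> discards the value at \<open>t 0\<close>,
      which the independence condition does not involve; the remaining indices shift by one.\<close>
    have r: "(\<lambda>\<xi>. \<lambda>j\<in>{..<m}. \<xi> (Suc j)) \<in> measurable (PiM {..m} (\<lambda>_. Rn n)) (PiM {..<m} (\<lambda>_. Rn n))"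
      by (intro measurable_restrict measurable_component_singleton) auto
    have "distr P (PiM {..<m} (\<lambda>_. Rn n)) (\<lambda>\<omega>. \<lambda>j\<in>{..<m}. ?I j \<omega>)
      = distr P (PiM {..<m} (\<lambda>_. Rn n)) ((\<lambda>\<xi>. \<lambda>j\<in>{..<m}. \<xi> (Suc j)) \<circ> (\<lambda>\<omega>. \<lambda>j\<in>{..m}. ?D j \<omega>))"
      by (intro arg_cong[of _ _ "distr _ _"]) (auto simp: fun_eq_iff restrict_def)
    also have "\<dots> = distr (PiM {..m} ?\<nu>) (PiM {..<m} (\<lambda>_. Rn n)) (\<lambda>\<xi>. \<lambda>j\<in>{..<m}. \<xi> (Suc j))"
      using law[of t m] t by (subst distr_distr[symmetric, OF r D]) auto
    also have "\<dots> = distr (PiM {..m} ?\<nu>) (PiM {..<m} (\<lambda>j. ?\<nu> (Suc j))) (\<lambda>\<xi>. \<lambda>j\<in>{..<m}. \<xi> (Suc j))"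
      using t by (intro distr_cong refl sets_PiM_cong) (auto simp: sets_\<nu> less_imp_le)
    also have "\<dots> = PiM {..<m} (\<lambda>j. ?\<nu> (Suc j))"
      using t by (intro distr_PiM_reindex prob_\<nu>) (auto split: nat.split simp: less_imp_le)
    also have "\<dots> = PiM {..<m} (\<lambda>j. distr P (Rn n) (?I j))"
      using t nonneg by (intro PiM_cong refl) (simp add: increment less_imp_le)
    finally show ?thesis
      using False I by (subst indep_vars_iff_distr_eq_PiM') auto
  qed
  have cont: "((\<lambda>s. measure P {\<omega> \<in> space P.
      L2_set (\<lambda>i. (\<lambda>i\<in>{..<n}. X s i \<omega>) i - (\<lambda>i\<in>{..<n}. X t i \<omega>) i) {..<n} > \<epsilon>}) \<longlongrightarrow> 0) (at t within {0..})"
    if t: "0 \<le> t" and \<epsilon>: "0 < \<epsilon>" for t \<epsilon> :: real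
  proof -
    let ?q = "\<lambda>x::nat \<Rightarrow> real. \<Sum>i<n. (x i)\<^sup>2"
    \<comment> \<open>\<open>?f\<close> is bounded and continuous, vanishes at zero and equals
      \<open>1\<close> where the Euclidean norm is at least \<epsilon>. Its integral
      \<open>g h\<close> therefore bounds the probability of an increment larger than \<epsilon>
      over a time span \<open>h\<close>, and weak continuity makes it tend to
      \<open>g 0 = 0\<close>.\<close>
    let ?f = "\<lambda>x. min 1 (?q x / \<epsilon>\<^sup>2)"
    define g where "g h = integral\<^sup>L (\<nu> h) ?f" for h
    have q0: "0 \<le> ?q x" for x by (intro sum_nonneg) simp
    have fm: "?f \<in> borel_measurable (Rn n)" by measurable
    have fc: "continuous_map (Rn_top n) euclideanreal ?f"
      by (intro continuous_map_real_min continuous_map_sum continuous_map_real_pow continuous_map_real_divide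
          continuous_map_product_projection) (use \<epsilon> in auto)
    have fb: "bounded (?f ` A)" for A
      using q0 by (intro boundedI[of _ 1]) (auto simp: abs_le_iff min_le_iff_disj intro: order_trans[of _ 0])
    have g_cont: "continuous_on {0..} g"
      using \<nu> fc fb unfolding continuous_conv_semigroup_def g_def by blast
    have g0: "g 0 = 0"
      unfolding g_def \<nu>0 by (subst integral_return[OF _ fm]) (auto simp: space_PiM)
    have "((\<lambda>s. g \<bar>s - t\<bar>) \<longlongrightarrow> g \<bar>t - t\<bar>) (at t within {0..})"
    proof -
      have "continuous_on {0..} (\<lambda>s. g \<bar>s - t\<bar>)"
        by (intro continuous_on_compose2[OF g_cont] continuous_intros) auto
      then show ?thesis using t unfolding continuous_on_def by blast
    qed
    then have lim: "((\<lambda>s. g \<bar>s - t\<bar>) \<longlongrightarrow> 0) (at t within {0..})" by (simp add: g0)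
    have bound: "measure P {\<omega> \<in> space P.
      L2_set (\<lambda>i. (\<lambda>i\<in>{..<n}. X s i \<omega>) i - (\<lambda>i\<in>{..<n}. X t i \<omega>) i) {..<n} > \<epsilon>} \<le> g \<bar>s - t\<bar>" if s: "0 \<le> s" for s
    proof -
      \<comment> \<open>The norm of an increment is symmetric in \<open>s\<close> and
        \<open>t\<close>, so the two times may be put in order before stationarity is used.\<close>
      define a b where "a = min s t" and "b = max s t"
      have ab: "0 \<le> a" "a \<le> b" "b - a = \<bar>s - t\<bar>" using s t by (auto simp: a_def b_def)
      let ?D = "\<lambda>\<omega>. \<lambda>i\<in>{..<n}. X b i \<omega> - X a i \<omega>"
      have D: "?D \<in> measurable P (Rn n)" using ab by (intro V2) auto
      have L2: "L2_set (\<lambda>i. (\<lambda>i\<in>{..<n}. X s i \<omega>) i - (\<lambda>i\<in>{..<n}. X t i \<omega>) i) {..<n} = sqrt (?q (?D \<omega>))" for \<omega>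
        unfolding L2_set_def
        by (intro arg_cong[of _ _ sqrt] sum.cong) (auto simp: a_def b_def min_def max_def power2_commute)
      have "{\<omega> \<in> space P. sqrt (?q (?D \<omega>)) > \<epsilon>} \<subseteq> {\<omega> \<in> space P. 1 \<le> ?f (?D \<omega>)}"
      proof safe
        fix \<omega> assume "sqrt (?q (?D \<omega>)) > \<epsilon>"
        then have "\<epsilon>\<^sup>2 \<le> ?q (?D \<omega>)"
          using \<epsilon> real_less_rsqrt power_mono[of \<epsilon> "sqrt (?q (?D \<omega>))" 2] q0[of "?D \<omega>"] by simp
        then show "1 \<le> ?f (?D \<omega>)" using \<epsilon> by simp
      qed
      moreover have "{\<omega> \<in> space P. 1 \<le> ?f (?D \<omega>)} \<in> sets P"
        by (rule borel_measurable_le[OF borel_measurable_const measurable_compose[OF D fm]])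
      ultimately have "measure P {\<omega> \<in> space P. sqrt (?q (?D \<omega>)) > \<epsilon>} \<le> measure P {\<omega> \<in> space P. 1 \<le> ?f (?D \<omega>)}"
        by (rule finite_measure_mono)
      \<comment> \<open>Markov's inequality at level \<open>1\<close>.\<close>
      also have "\<dots> \<le> integral\<^sup>L P (\<lambda>\<omega>. ?f (?D \<omega>)) / 1"
      proof (rule integral_Markov_inequality_measure[where A="{}"])
        show "integrable P (\<lambda>\<omega>. ?f (?D \<omega>))"
          using measurable_compose[OF D fm] q0
          by (intro integrable_const_bound[where B=1]) (auto simp: abs_le_iff min_le_iff_disj intro: order_trans[of _ 0])
      qed (use q0 in auto)
      also have "\<dots> = integral\<^sup>L (distr P (Rn n) ?D) ?f"
        using integral_distr[OF D fm] by simp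
      also have "\<dots> = g \<bar>s - t\<bar>"
        using ab increment[of a b] by (simp add: g_def)
      finally show ?thesis unfolding L2 .
    qed
    show ?thesis
      using bound by (intro tendsto_sandwich[OF _ _ tendsto_const lim]) (auto simp: eventually_at_filter)
  qed
  have sub: "(\<lambda>i\<in>{..<n}. (\<lambda>i\<in>{..<n}. f i) i - (\<lambda>i\<in>{..<n}. h i) i) = (\<lambda>i\<in>{..<n}. f i - h i)"
    for f h :: "nat \<Rightarrow> real" by auto
  show ?thesis
    unfolding levy_process_def sub
    using P V start indep cont increment marginal by auto
qed

section \<open>The coordinate process indexed by times and vectors\<close>

lemma cylindrical_levy_coordinates:
  fixes T :: "'a::real_vector topology" and \<mu> :: "real \<Rightarrow> ('a \<Rightarrow> real) set \<Rightarrow> ennreal"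
  assumes \<mu>: "\<And>t. t \<ge> 0 \<Longrightarrow> cylindrical_measure T (\<mu> t)"
    and semigroup: "\<And>n (\<psi> :: nat \<Rightarrow> 'a). n \<ge> 1 \<Longrightarrow>
           continuous_conv_semigroup n (\<lambda>t. cyl_image T (\<mu> t) n \<psi>)"
  shows "\<exists>P :: (real \<times> 'a \<Rightarrow> real) measure. prob_space P \<and>
    (\<forall>t\<ge>0. \<forall>\<psi>. (\<lambda>\<omega>. \<omega> (t, \<psi>)) \<in> borel_measurable P) \<and>
    (\<forall>m t n (\<psi> :: nat \<Rightarrow> 'a). 1 \<le> n \<longrightarrow> 0 \<le> t 0 \<longrightarrow> (\<forall>j<m. t j < t (Suc j)) \<longrightarrow>
      distr P (PiM {..m} (\<lambda>_. Rn n))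
        (\<lambda>\<omega>. \<lambda>j\<in>{..m}. \<lambda>i\<in>{..<n}. \<omega> (t j, \<psi> i) - (case j of 0 \<Rightarrow> 0 | Suc k \<Rightarrow> \<omega> (t k, \<psi> i)))
      = PiM {..m} (\<lambda>j. cyl_image T (\<mu> (t j - (case j of 0 \<Rightarrow> 0 | Suc k \<Rightarrow> t k))) n \<psi>))"
proof -
  \<comment> \<open>The total mass is read off from the projection along the zero vector: the
    cylinder over the whole line is the whole dual.\<close>
  have total: "\<mu> t (dual_space T) = 1" if t: "0 \<le> t" for t
  proof -
    interpret prob_space "cyl_image T (\<mu> t) 1 (\<lambda>_. 0)"
      using semigroup[of 1 "\<lambda>_. 0"] t by (simp add: continuous_conv_semigroup_def)
    have "space (cyl_image T (\<mu> t) 1 (\<lambda>_. 0)) = space (Rn 1)" by (simp add: cyl_image_def)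
    moreover have "cyl_set T 1 (\<lambda>_. 0) (space (Rn 1)) = dual_space T"
      by (auto simp: cyl_set_def cyl_proj_def space_PiM)
    ultimately show ?thesis
      using emeasure_space_1 emeasure_cyl_image[OF \<mu>[OF t], of 1 "space (Rn 1)" "\<lambda>_. 0"] by simp
  qed
  \<comment> \<open>\<open>max 0 t\<close> supplies a probability measure at negative times as well,
    as the locale requires.\<close>
  have "\<exists>Q. \<forall>t. prob_space (Q t) \<and> sets (Q t) = sets (PiM UNIV (\<lambda>_. borel)) \<and>
    (\<forall>n \<psi>. distr (Q t) (Rn n) (cyl_proj n \<psi>) = cyl_image T (\<mu> (max 0 t)) n \<psi>)"
    by (intro choice allI cylindrical_measure_extension \<mu> total) auto
  then obtain Q where *: "\<forall>t. prob_space (Q t) \<and> sets (Q t) = sets (PiM UNIV (\<lambda>_. borel)) \<and>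
    (\<forall>n \<psi>. distr (Q t) (Rn n) (cyl_proj n \<psi>) = cyl_image T (\<mu> (max 0 t)) n \<psi>)"
    by (rule exE)
  have Q: "prob_space (Q t)" "sets (Q t) = sets (PiM UNIV (\<lambda>_. borel))"
    "distr (Q t) (Rn n) (cyl_proj n \<psi>) = cyl_image T (\<mu> (max 0 t)) n \<psi>" for t n \<psi>
    using * by auto
  interpret function_conv_semigroup Q
  proof (rule function_conv_semigroup.intro)
    fix s t :: real assume st: "0 \<le> s" "0 \<le> t"
    interpret S: prob_space "Q s" by (rule Q)
    interpret T: prob_space "Q t" by (rule Q)
    interpret pair_prob_space "Q s" "Q t" ..
    note [measurable_cong] = Q(2)[of s] Q(2)[of t]
    have add: "(\<lambda>(x, y) i. x i + y i) \<in> measurable (Q s \<Otimes>\<^sub>M Q t) (PiM UNIV (\<lambda>_. borel))"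
      by (simp add: split_beta') (intro measurable_PiM_single'; simp; measurable)
    show "distr (Q s \<Otimes>\<^sub>M Q t) (PiM UNIV (\<lambda>_. borel)) (\<lambda>(x, y) i. x i + y i) = Q (s + t)"
    \<comment> \<open>Both sides are compared under finite-dimensional projections, where the
      semigroup law is the hypothesis.\<close>
    proof (rule measure_eqI_cyl_proj)
      fix n :: nat and \<psi> :: "nat \<Rightarrow> 'a" assume n: "1 \<le> n"
      have "Rn_conv n (cyl_image T (\<mu> s) n \<psi>) (cyl_image T (\<mu> t) n \<psi>) = cyl_image T (\<mu> (s + t)) n \<psi>"
        using semigroup[OF n, of \<psi>] st by (simp add: continuous_conv_semigroup_def)
      then show "distr (distr (Q s \<Otimes>\<^sub>M Q t) (PiM UNIV (\<lambda>_. borel)) (\<lambda>(x, y) i. x i + y i)) (Rn n) (cyl_proj n \<psi>)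
        = distr (Q (s + t)) (Rn n) (cyl_proj n \<psi>)"
        using st by (simp add: cyl_proj_convolution[OF Q(1,2) Q(1,2)] Q(3))
    qed (auto intro: Q(1) prob_space_distr add simp: Q(2))
  qed (rule Q)+
  show ?thesis
  proof (intro exI[of _ lim] conjI allI impI)
    show "prob_space lim" by (rule P.prob_space_axioms)
    show "(\<lambda>\<omega>. \<omega> (t, \<psi>)) \<in> borel_measurable lim" if "0 \<le> t" for t \<psi>
      using that by (subst measurable_cong_sets[OF sets_lim refl]) (intro measurable_component_singleton; simp)
    show "distr lim (PiM {..m} (\<lambda>_. Rn n))
        (\<lambda>\<omega>. \<lambda>j\<in>{..m}. \<lambda>i\<in>{..<n}. \<omega> (t j, \<psi> i) - (case j of 0 \<Rightarrow> 0 | Suc k \<Rightarrow> \<omega> (t k, \<psi> i)))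
      = PiM {..m} (\<lambda>j. cyl_image T (\<mu> (t j - (case j of 0 \<Rightarrow> 0 | Suc k \<Rightarrow> t k))) n \<psi>)"
      if "1 \<le> n" "0 \<le> t 0" "\<forall>j<m. t j < t (Suc j)" for m t n and \<psi> :: "nat \<Rightarrow> 'a"
    proof -
      have mono: "0 \<le> t j - (case j of 0 \<Rightarrow> 0 | Suc k \<Rightarrow> t k)" if "j \<le> m" for j
        using that \<open>0 \<le> t 0\<close> \<open>\<forall>j<m. t j < t (Suc j)\<close> by (auto split: nat.split simp: less_imp_le)
      show ?thesis
        using mono
        by (intro trans[OF distr_increments[of t m n \<psi>, OF that(2) _ that(1)]] PiM_cong refl)
          (use that(3) in \<open>auto simp: Q(3)[unfolded cyl_proj_def] max_absorb2\<close>)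
    qed
  qed
qed

lemma continuous_conv_semigroup_prob:
  assumes "continuous_conv_semigroup n \<nu>" "0 \<le> t"
  shows "prob_space (\<nu> t)"
  using assms by (simp add: continuous_conv_semigroup_def)

text \<open>The cylinder of functionals whose coordinates satisfy \<open>R\<close> is the whole
  dual, so it has full measure. In this way relations valid throughout the dual become almost sure
  relations.\<close>

lemma AE_cyl_image:
  assumes \<mu>: "cylindrical_measure T \<mu>" and n: "1 \<le> n" and prob: "prob_space (cyl_image T \<mu> n \<psi>)"
    and A: "{x \<in> space (Rn n). R x} \<in> sets (Rn n)" and R: "\<And>f. f \<in> dual_space T \<Longrightarrow> R (cyl_proj n \<psi> f)"
  shows "AE x in cyl_image T \<mu> n \<psi>. R x"
proof -
  interpret prob_space "cyl_image T \<mu> n \<psi>" by (rule prob)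
  have sets: "sets (cyl_image T \<mu> n \<psi>) = sets (Rn n)" by (simp add: cyl_image_def)
  then have sp: "space (cyl_image T \<mu> n \<psi>) = space (Rn n)" by (rule sets_eq_imp_space_eq)
  have "cyl_set T n \<psi> {x \<in> space (Rn n). R x} = cyl_set T n \<psi> (space (Rn n))"
    using R by (auto simp: cyl_set_def cyl_proj_def space_PiM)
  then have "emeasure (cyl_image T \<mu> n \<psi>) {x \<in> space (Rn n). R x} = 1"
    using A emeasure_space_1 by (simp add: sp emeasure_cyl_image[OF \<mu> n])
  then show ?thesis
    using A by (intro AE_I_eq_1) (simp_all add: sp sets)
qed

section \<open>Classes of random variables and their linear operations\<close>

definition ae_class :: "'w measure \<Rightarrow> ('w \<Rightarrow> real) \<Rightarrow> ('w \<Rightarrow> real) set" where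
  "ae_class P f = {h \<in> borel_measurable P. AE \<omega> in P. h \<omega> = f \<omega>}"

lemma ae_class_in_L0: "f \<in> borel_measurable P \<Longrightarrow> ae_class P f \<in> L0 P"
proof -
  assume f: "f \<in> borel_measurable P"
  let ?R = "{(f, g). f \<in> borel_measurable P \<and> g \<in> borel_measurable P \<and> (AE \<omega> in P. f \<omega> = g \<omega>)}"
  have "ae_class P f = ?R `` {f}"
    using f by (auto simp: ae_class_def elim: eventually_mono)
  then show ?thesis
    unfolding L0_def using quotientI[OF f, of ?R] by simp
qed

lemma self_in_ae_class: "f \<in> borel_measurable P \<Longrightarrow> f \<in> ae_class P f"
  by (simp add: ae_class_def)

text \<open>Almost sure equality of \<open>k\<close> with the sum is enough because classes are
  compared; additivity of the process is obtained in this form.\<close>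

lemma ae_class_add:
  assumes "f \<in> borel_measurable P" "g \<in> borel_measurable P" and eq: "AE \<omega> in P. k \<omega> = f \<omega> + g \<omega>"
  shows "ae_class P k = L0_add P (ae_class P f) (ae_class P g)"
proof (intro set_eqI iffI)
  fix h assume h: "h \<in> ae_class P k"
  then have "AE \<omega> in P. h \<omega> = f \<omega> + g \<omega>"
    using eq by (auto simp: ae_class_def)
  with h show "h \<in> L0_add P (ae_class P f) (ae_class P g)"
    using self_in_ae_class[OF assms(1)] self_in_ae_class[OF assms(2)] unfolding L0_add_def ae_class_def by blast
next
  fix h assume "h \<in> L0_add P (ae_class P f) (ae_class P g)"
  then obtain f' g' where h: "h \<in> borel_measurable P" and ae: "AE \<omega> in P. f' \<omega> = f \<omega>" "AE \<omega> in P. g' \<omega> = g \<omega>"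
    "AE \<omega> in P. h \<omega> = f' \<omega> + g' \<omega>"
    by (auto simp: ae_class_def L0_add_def)
  from ae eq have "AE \<omega> in P. h \<omega> = k \<omega>" by eventually_elim simp
  with h show "h \<in> ae_class P k" by (simp add: ae_class_def)
qed

lemma ae_class_scale:
  assumes "f \<in> borel_measurable P" and eq: "AE \<omega> in P. k \<omega> = c * f \<omega>"
  shows "ae_class P k = L0_scale P c (ae_class P f)"
proof (intro set_eqI iffI)
  fix h assume h: "h \<in> ae_class P k"
  then have "AE \<omega> in P. h \<omega> = c * f \<omega>"
    using eq by (auto simp: ae_class_def)
  with h show "h \<in> L0_scale P c (ae_class P f)"
    using self_in_ae_class[OF assms(1)] unfolding L0_scale_def ae_class_def by blast
next
  fix h assume "h \<in> L0_scale P c (ae_class P f)"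
  then obtain f' where h: "h \<in> borel_measurable P" and ae: "AE \<omega> in P. f' \<omega> = f \<omega>" "AE \<omega> in P. h \<omega> = c * f' \<omega>"
    by (auto simp: ae_class_def L0_scale_def)
  from ae eq have "AE \<omega> in P. h \<omega> = k \<omega>" by eventually_elim simp
  with h show "h \<in> ae_class P k" by (simp add: ae_class_def)
qed

theorem theorem3p13:
  fixes T :: "'a::real_vector topology"
    and \<mu> :: "real \<Rightarrow> ('a \<Rightarrow> real) set \<Rightarrow> ennreal"
  assumes "locally_convex_space T" and "Hausdorff_space T"
    and "\<And>t. t \<ge> 0 \<Longrightarrow> cylindrical_measure T (\<mu> t)"
    and "\<And>n (\<psi> :: nat \<Rightarrow> 'a). n \<ge> 1 \<Longrightarrow>
           continuous_conv_semigroup n (\<lambda>t. cyl_image T (\<mu> t) n \<psi>)"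
  shows "\<exists>(P :: (real \<times> 'a \<Rightarrow> real) measure) (L :: real \<Rightarrow> 'a \<Rightarrow> ((real \<times> 'a \<Rightarrow> real) \<Rightarrow> real) set).
           prob_space P \<and>
           cylindrical_process P L \<and>
           (\<forall>t\<ge>0. \<forall>n\<ge>1. \<forall>(\<psi> :: nat \<Rightarrow> 'a). \<forall>\<Gamma>\<in>sets (Rn n). \<forall>X.
              (\<forall>i<n. X i \<in> L t (\<psi> i)) \<longrightarrow>
              emeasure P {\<omega> \<in> space P. (\<lambda>i\<in>{..<n}. X i \<omega>) \<in> \<Gamma>} = \<mu> t (cyl_set T n \<psi> \<Gamma>)) \<and>
           cylindrical_levy_process P L"
proof -
  obtain P :: "(real \<times> 'a \<Rightarrow> real) measure" where P: "prob_space P"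
    and coord: "\<And>t \<psi>. t \<ge> 0 \<Longrightarrow> (\<lambda>\<omega>. \<omega> (t, \<psi>)) \<in> borel_measurable P"
    and law: "\<And>m t n (\<psi> :: nat \<Rightarrow> 'a). 1 \<le> n \<Longrightarrow> 0 \<le> t 0 \<Longrightarrow> \<forall>j<m. t j < t (Suc j) \<Longrightarrow>
      distr P (PiM {..m} (\<lambda>_. Rn n))
        (\<lambda>\<omega>. \<lambda>j\<in>{..m}. \<lambda>i\<in>{..<n}. \<omega> (t j, \<psi> i) - (case j of 0 \<Rightarrow> 0 | Suc k \<Rightarrow> \<omega> (t k, \<psi> i)))
      = PiM {..m} (\<lambda>j. cyl_image T (\<mu> (t j - (case j of 0 \<Rightarrow> 0 | Suc k \<Rightarrow> t k))) n \<psi>)"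
    using cylindrical_levy_coordinates[of T \<mu>, OF assms(3,4)] by blast
  interpret prob_space P by (rule P)
  \<comment> \<open>On the product space the process is the coordinate at
    \<open>(t, \<psi>)\<close>, taken modulo almost sure equality.\<close>
  define L where "L t \<psi> = ae_class P (\<lambda>\<omega>. \<omega> (t, \<psi>))" for t and \<psi> :: 'a
  have levy: "levy_process n P (\<lambda>t \<omega>. \<lambda>i\<in>{..<n}. X t i \<omega>)"
    if n: "1 \<le> n" and X: "\<And>t i. 0 \<le> t \<Longrightarrow> i < n \<Longrightarrow> X t i \<in> L t (\<psi> i)" for n \<psi> X
  proof (rule levy_processI[OF P assms(4)[OF n, of \<psi>]])
    show meas: "X t i \<in> borel_measurable P" if "0 \<le> t" "i < n" for t i
      using X[OF that] by (simp add: L_def ae_class_def)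
    fix m :: nat and t :: "nat \<Rightarrow> real"
    assume t: "0 \<le> t 0" and "\<And>j. j < m \<Longrightarrow> t j < t (Suc j)"
    then have t': "\<forall>j<m. t j < t (Suc j)" by blast
    have nonneg: "0 \<le> t j" if "j \<le> m" for j
      using that
    proof (induction j)
      case (Suc j)
      then show ?case using spec[OF t', of j] by simp
    qed (use t in simp)
    have D: "(\<lambda>\<omega>. \<lambda>j\<in>{..m}. \<lambda>i\<in>{..<n}. Y (t j) i \<omega> - (case j of 0 \<Rightarrow> 0 | Suc k \<Rightarrow> Y (t k) i \<omega>))
      \<in> measurable P (PiM {..m} (\<lambda>_. Rn n))"
      if "\<And>t i. 0 \<le> t \<Longrightarrow> i < n \<Longrightarrow> Y t i \<in> borel_measurable P" for Y
    proof (intro measurable_restrict)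
      fix j i assume "j \<in> {..m}" "i \<in> {..<n}"
      then show "(\<lambda>\<omega>. Y (t j) i \<omega> - (case j of 0 \<Rightarrow> 0 | Suc k \<Rightarrow> Y (t k) i \<omega>)) \<in> borel_measurable P"
        using nonneg by (cases j) (auto intro!: borel_measurable_diff that)
    qed
    \<comment> \<open>Only finitely many representatives enter, so their exceptional null sets unite
      to a null set and the joint law is that of the coordinates.\<close>
    have "AE \<omega> in P. \<forall>j\<in>{..m}. \<forall>i\<in>{..<n}. X (t j) i \<omega> = \<omega> (t j, \<psi> i)"
      using X nonneg by (intro AE_finite_allI) (auto simp: L_def ae_class_def)
    then have "AE \<omega> in P. (\<lambda>j\<in>{..m}. \<lambda>i\<in>{..<n}. X (t j) i \<omega> - (case j of 0 \<Rightarrow> 0 | Suc k \<Rightarrow> X (t k) i \<omega>))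
      = (\<lambda>j\<in>{..m}. \<lambda>i\<in>{..<n}. \<omega> (t j, \<psi> i) - (case j of 0 \<Rightarrow> 0 | Suc k \<Rightarrow> \<omega> (t k, \<psi> i)))"
      by eventually_elim (auto simp: fun_eq_iff restrict_def split: nat.split)
    then show "distr P (PiM {..m} (\<lambda>_. Rn n))
        (\<lambda>\<omega>. \<lambda>j\<in>{..m}. \<lambda>i\<in>{..<n}. X (t j) i \<omega> - (case j of 0 \<Rightarrow> 0 | Suc k \<Rightarrow> X (t k) i \<omega>))
      = PiM {..m} (\<lambda>j. cyl_image T (\<mu> (t j - (case j of 0 \<Rightarrow> 0 | Suc k \<Rightarrow> t k))) n \<psi>)"
      unfolding law[OF n t t', symmetric]
      using D[of X] D[of "\<lambda>t i \<omega>. \<omega> (t, \<psi> i)"] meas coord by (intro distr_cong_AE) auto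
  qed
  have marginal: "distr P (Rn n) (\<lambda>\<omega>. \<lambda>i\<in>{..<n}. X i \<omega>) = cyl_image T (\<mu> t) n \<psi>"
    if n: "1 \<le> n" and t: "0 \<le> t" and X: "\<And>i. i < n \<Longrightarrow> X i \<in> L t (\<psi> i)" for n t \<psi> X
  proof -
    have "AE \<omega> in P. \<forall>i\<in>{..<n}. X i \<omega> = \<omega> (t, \<psi> i)"
      using X by (intro AE_finite_allI) (auto simp: L_def ae_class_def)
    then have "AE \<omega> in P. (\<lambda>i\<in>{..<n}. X i \<omega>) = (\<lambda>i\<in>{..<n}. \<omega> (t, \<psi> i))"
      by eventually_elim (auto simp: fun_eq_iff)
    then have "distr P (Rn n) (\<lambda>\<omega>. \<lambda>i\<in>{..<n}. X i \<omega>) = distr P (Rn n) (\<lambda>\<omega>. \<lambda>i\<in>{..<n}. \<omega> (t, \<psi> i))"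
      using X t coord by (intro distr_cong_AE measurable_restrict) (auto simp: L_def ae_class_def)
    also have "\<dots> = cyl_image T (\<mu> t) n \<psi>"
      using t coord continuous_conv_semigroup_prob[OF assms(4)[OF n] t] law[OF n, of "\<lambda>_. t" 0 \<psi>]
      by (intro distr_increments_0[where \<nu>="\<lambda>t. cyl_image T (\<mu> t) n \<psi>"]) (auto simp: cyl_image_def)
    finally show ?thesis .
  qed
  \<comment> \<open>Carries relations that every functional in the dual satisfies over to the
    coordinates at one fixed time.\<close>
  have dual_AE: "AE \<omega> in P. R (\<lambda>i\<in>{..<n}. \<omega> (t, \<psi> i))"
    if n: "1 \<le> n" and t: "0 \<le> t" and A: "{x \<in> space (Rn n). R x} \<in> sets (Rn n)"
      and R: "\<And>f. f \<in> dual_space T \<Longrightarrow> R (cyl_proj n \<psi> f)" for n t \<psi> R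
  proof -
    have "prob_space (cyl_image T (\<mu> t) n \<psi>)"
      by (rule continuous_conv_semigroup_prob[OF assms(4)[OF n] t])
    from AE_cyl_image[OF assms(3)[OF t] n this A R]
    have "AE x in distr P (Rn n) (\<lambda>\<omega>. \<lambda>i\<in>{..<n}. \<omega> (t, \<psi> i)). R x"
      using t coord by (subst marginal[OF n t]) (auto simp: L_def ae_class_def)
    moreover have "(\<lambda>\<omega>. \<lambda>i\<in>{..<n}. \<omega> (t, \<psi> i)) \<in> measurable P (Rn n)"
      using t by (intro measurable_restrict coord)
    ultimately show ?thesis using A by (simp add: AE_distr_iff)
  qed
  have rv: "cylindrical_rv P (L t)" if t: "0 \<le> t" for t
    unfolding cylindrical_rv_def
  proof (intro conjI allI)
    show "L t \<psi> \<in> L0 P" for \<psi>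
      unfolding L_def by (intro ae_class_in_L0 coord t)
    fix \<psi> \<phi> :: 'a and c :: real
    \<comment> \<open>Additivity becomes a linear relation in three-dimensional space between the
      coordinates at the listed vectors; homogeneity is treated in the same way with two
      vectors.\<close>
    have "AE \<omega> in P. (\<lambda>x. x 0 = x 1 + x 2) (\<lambda>i\<in>{..<3::nat}. \<omega> (t, [\<psi> + \<phi>, \<psi>, \<phi>] ! i))"
    proof (rule dual_AE[OF _ t])
      show "{x \<in> space (Rn 3). x 0 = x 1 + x 2} \<in> sets (Rn 3)" by measurable
      show "(\<lambda>x. x 0 = x 1 + x 2) (cyl_proj 3 (\<lambda>i. [\<psi> + \<phi>, \<psi>, \<phi>] ! i) f)" if "f \<in> dual_space T" for f
        using that by (simp add: dual_space_def cyl_proj_def linear_add numeral_2_eq_2)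
    qed simp
    then show "L t (\<psi> + \<phi>) = L0_add P (L t \<psi>) (L t \<phi>)"
      unfolding L_def by (intro ae_class_add coord t) (simp add: numeral_2_eq_2)
    have "AE \<omega> in P. (\<lambda>x. x 0 = c * x 1) (\<lambda>i\<in>{..<2::nat}. \<omega> (t, [c *\<^sub>R \<psi>, \<psi>] ! i))"
    proof (rule dual_AE[OF _ t])
      show "{x \<in> space (Rn 2). x 0 = c * x 1} \<in> sets (Rn 2)" by measurable
      show "(\<lambda>x. x 0 = c * x 1) (cyl_proj 2 (\<lambda>i. [c *\<^sub>R \<psi>, \<psi>] ! i) f)" if "f \<in> dual_space T" for f
        using that by (simp add: dual_space_def cyl_proj_def linear_cmul)
    qed simp
    then show "L t (c *\<^sub>R \<psi>) = L0_scale P c (L t \<psi>)"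
      unfolding L_def by (intro ae_class_scale coord t) simp
  qed
  then have process: "cylindrical_process P L" by (simp add: cylindrical_process_def)
  have "emeasure P {\<omega> \<in> space P. (\<lambda>i\<in>{..<n}. X i \<omega>) \<in> \<Gamma>} = \<mu> t (cyl_set T n \<psi> \<Gamma>)"
    if t: "0 \<le> t" and n: "1 \<le> n" and \<Gamma>: "\<Gamma> \<in> sets (Rn n)" and X: "\<forall>i<n. X i \<in> L t (\<psi> i)" for t n \<psi> \<Gamma> X
  proof -
    have "(\<lambda>\<omega>. \<lambda>i\<in>{..<n}. X i \<omega>) \<in> measurable P (Rn n)"
      using X by (intro measurable_restrict) (auto simp: L_def ae_class_def)
    then have "emeasure P {\<omega> \<in> space P. (\<lambda>i\<in>{..<n}. X i \<omega>) \<in> \<Gamma>} = emeasure (distr P (Rn n) (\<lambda>\<omega>. \<lambda>i\<in>{..<n}. X i \<omega>)) \<Gamma>"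
      using \<Gamma> by (simp add: emeasure_distr vimage_def Int_def conj_commute)
    also have "\<dots> = \<mu> t (cyl_set T n \<psi> \<Gamma>)"
      using X by (subst marginal[OF n t]) (auto simp: emeasure_cyl_image[OF assms(3)[OF t] n \<Gamma>])
    finally show ?thesis .
  qed
  moreover have "cylindrical_levy_process P L"
    unfolding cylindrical_levy_process_def
  proof (intro conjI allI impI process)
    fix n X and \<psi> :: "nat \<Rightarrow> 'a"
    assume "1 \<le> n" "\<forall>t\<ge>0. \<forall>i<n. X t i \<in> L t (\<psi> i)"
    then show "levy_process n P (\<lambda>t \<omega>. \<lambda>i\<in>{..<n}. X t i \<omega>)"
      by (intro levy[of n X \<psi>]) auto
  qed
  ultimately show ?thesis
    using P process by (intro exI[of _ P] exI[of _ L]) blast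
qed

end
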